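(* Let $p\ge 1$ be an integer. Among all $p$-sided polygonal cusps with a fixed hyperbolic area, the one with the least perimeter is the regular one.
   Context: Polygonal cusp: take a collection of $p$ hyperbolic triangles, each having exactly one ideal vertex (so each has one side of finite length, opposite to the ideal vertex, and two sides of infinite length). Arrange them cyclically and glue, by isometries matching the non-ideal endpoints, one infinite side of each triangle to an infinite side of the next one, so that the result is a once-punctured disk (all ideal vertices being identified to the puncture) with a hyperbolic metric and a piecewise geodesic boundary of finite length made of the $p$ finite sides. Such an object is a $p$-sided polygonal cusp, and the boundary geodesic segments are its sides. If the $i$-th triangle has finite side of length $l_i$ and non-ideal angles $\theta_i,\phi_i$, then the side lengths of the polygonal cusp are the $l_i$ and its interior angles are $\phi_{i-1}+\theta_i$ (indices mod $p$). The perimeter is the sum of the side lengths. A polygonal cusp is called regular if all its side lengths are equal and all its interior angles are equal. *)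

theory Defs
  imports "HOL-Analysis.Analysis"
begin

text \<open>
  The hyperbolic plane of curvature \<open>-1\<close> in the Klein model: its points are those of
  \<open>ball 0 1\<close> in the Euclidean plane, its ideal points those of \<open>sphere 0 1\<close>, and its
  geodesics are Euclidean chords, so that geodesic triangles, also with ideal vertices, are Euclidean
  convex hulls.  The Riemannian metric is \<open>klein_metric\<close>; since its determinant at \<open>z\<close> is
  \<open>(1 - |z|^2)^(-3)\<close>, the area element is \<open>(1 - |z|^2)^(-3/2)\<close> times Lebesgue measure.
\<close>

definition klein_metric :: "real^2 \<Rightarrow> real^2 \<Rightarrow> real^2 \<Rightarrow> real" where
  "klein_metric z u v =
     (u \<bullet> v) / (1 - (norm z)\<^sup>2) + (z \<bullet> u) * (z \<bullet> v) / (1 - (norm z)\<^sup>2)\<^sup>2"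

definition hyp_dist :: "real^2 \<Rightarrow> real^2 \<Rightarrow> real" where
  "hyp_dist z w = arcosh ((1 - z \<bullet> w) / sqrt ((1 - (norm z)\<^sup>2) * (1 - (norm w)\<^sup>2)))"

text \<open>The angle at \<open>z\<close> between the geodesics from \<open>z\<close> towards \<open>v\<close> and \<open>w\<close>, each of
  which may be a point of the plane or an ideal point.\<close>

definition hyp_angle :: "real^2 \<Rightarrow> real^2 \<Rightarrow> real^2 \<Rightarrow> real" where
  "hyp_angle z v w =
     arccos (klein_metric z (v - z) (w - z) /
       sqrt (klein_metric z (v - z) (v - z) * klein_metric z (w - z) (w - z)))"

definition hyp_area :: "(real^2) set \<Rightarrow> real" where
  "hyp_area S = (LINT z:S|lborel. (1 - (norm z)\<^sup>2) powr (-3/2))"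

datatype triangle =
  Triangle (left_vertex: "real^2") (right_vertex: "real^2") (ideal_vertex: "real^2")

definition one_ideal_triangle :: "triangle \<Rightarrow> bool" where
  "one_ideal_triangle T \<longleftrightarrow>
     left_vertex T \<in> ball 0 1 \<and> right_vertex T \<in> ball 0 1 \<and> ideal_vertex T \<in> sphere 0 1 \<and>
     \<not> collinear {left_vertex T, right_vertex T, ideal_vertex T}"

definition triangle_area :: "triangle \<Rightarrow> real" where
  "triangle_area T = hyp_area (convex hull {left_vertex T, right_vertex T, ideal_vertex T})"

definition finite_side :: "triangle \<Rightarrow> real" where
  "finite_side T = hyp_dist (left_vertex T) (right_vertex T)"

definition left_angle :: "triangle \<Rightarrow> real" where
  "left_angle T = hyp_angle (left_vertex T) (right_vertex T) (ideal_vertex T)"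

definition right_angle :: "triangle \<Rightarrow> real" where
  "right_angle T = hyp_angle (right_vertex T) (left_vertex T) (ideal_vertex T)"

text \<open>
  A polygonal cusp is given by the cyclic list of its triangles.  The infinite side of the \<open>i\<close>-th
  triangle at its right vertex is glued to the infinite side of the next triangle (indices mod \<open>p\<close>)
  at its left vertex.  Each of these sides is a geodesic ray, and there is exactly one isometry
  between two rays that matches their endpoints, so the gluing involves no further data.  The
  triangles are abstract pieces: neither their positions in the plane nor the cyclic order of their
  vertices matter, as the gluing may use orientation-reversing isometries of the plane.
\<close>

definition polygonal_cusp :: "nat \<Rightarrow> triangle list \<Rightarrow> bool" where
  "polygonal_cusp p C \<longleftrightarrow> length C = p \<and> p \<ge> 1 \<and> (\<forall>T\<in>set C. one_ideal_triangle T)"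

definition cusp_area :: "triangle list \<Rightarrow> real" where
  "cusp_area C = (\<Sum>i<length C. triangle_area (C ! i))"

definition side_length :: "triangle list \<Rightarrow> nat \<Rightarrow> real" where
  "side_length C i = finite_side (C ! i)"

definition interior_angle :: "triangle list \<Rightarrow> nat \<Rightarrow> real" where
  "interior_angle C i =
     right_angle (C ! ((i + length C - 1) mod length C)) + left_angle (C ! i)"

definition perimeter :: "triangle list \<Rightarrow> real" where
  "perimeter C = (\<Sum>i<length C. side_length C i)"

definition regular_cusp :: "triangle list \<Rightarrow> bool" where
  "regular_cusp C \<longleftrightarrow>
     (\<forall>i<length C. \<forall>j<length C.
        side_length C i = side_length C j \<and> interior_angle C i = interior_angle C j)"

text \<open>
  The gluing alone does not make the hyperbolic metric complete at the puncture.  For an ideal point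
  \<open>\<xi>\<close>, the function \<open>horo \<xi>\<close> is the exponential of a Busemann function: it is constant on
  the horocycles based at \<open>\<xi>\<close> and is multiplied by \<open>exp (- t)\<close> when a point moves by
  distance \<open>t\<close> towards \<open>\<xi>\<close>.  A horocycle around the puncture, continued through all the
  triangles, closes up iff the product below is \<open>1\<close>.  This means that the holonomy around the puncture
  is parabolic, that is, that the metric is complete at the puncture.  Without this condition
  \<open>regular_cusp\<close> does not determine a cusp from its area: for \<open>p = 1\<close> every gluing is regular,
  also when the triangle is not isosceles.
\<close>

definition horo :: "real^2 \<Rightarrow> real^2 \<Rightarrow> real" where
  "horo \<xi> z = (1 - z \<bullet> \<xi>) / sqrt (1 - (norm z)\<^sup>2)"

definition complete_at_puncture :: "triangle list \<Rightarrow> bool" where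
  "complete_at_puncture C \<longleftrightarrow>
     (\<Prod>i<length C. horo (ideal_vertex (C ! i)) (left_vertex (C ! i)) /
                   horo (ideal_vertex (C ! i)) (right_vertex (C ! i))) = 1"

text \<open>Triangles with exactly one ideal vertex are determined up to isometry by the data compared here,
  so cusps of the same shape are isometric by an isometry that respects the triangles.\<close>

definition same_shape :: "triangle list \<Rightarrow> triangle list \<Rightarrow> bool" where
  "same_shape C D \<longleftrightarrow> length C = length D \<and>
     (\<forall>i<length C. finite_side (C ! i) = finite_side (D ! i) \<and>
        left_angle (C ! i) = left_angle (D ! i) \<and> right_angle (C ! i) = right_angle (D ! i))"

end

theory Submission
  imports Defs
begin

text \<open>
  Place the ideal vertex of a triangle at infinity of the upper half-plane.  Its finite side lies on a
  half-circle, its area is \<open>pi - \<theta> - \<phi>\<close>, and its finite side has length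
  \<open>g \<theta> + g \<phi>\<close> with \<open>g t = - ln (tan (t / 2))\<close>.  For a given area this length is minimal
  exactly when \<open>\<theta> = \<phi>\<close>, and the minimum is a strictly convex function of the area, so among all
  choices with a given total area the perimeter is minimal exactly when all triangles are congruent and
  isosceles.  Conversely, equal sides and equal interior angles force all triangles to be congruent, and
  completeness, which reads \<open>(\<Prod>i. sin (\<phi> i) / sin (\<theta> i)) = 1\<close>, then forces them to be isosceles.
\<close>

section \<open>Half-plane coordinates in the Klein disc\<close>

text \<open>The second derivative of g, \<open>cos t / (sin t)\<^sup>2\<close>, is positive only up
  to \<open>pi / 2\<close>, while one angle of a triangle may be obtuse. So Jensen's inequality
  cannot be applied to all 2p angles at once: the two angles of each triangle are first replaced by
  their mean, by a separate trigonometric inequality, and only these means, which lie below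
  \<open>pi / 2\<close>, enter a convexity argument. That argument uses the tangent of g at a single
  point: the area fixes the sum of the means, so the sum of the tangent values is the same for all
  competitors. Competitors may be incomplete at the puncture; the minimizer is complete by the
  symmetry of its triangles, and completeness matters only for identifying the equality case. The
  area formula is obtained by integration, slicing the Klein disc along the chords towards the ideal
  vertex.\<close>

locale ideal_frame =
  fixes \<xi> e :: "real^2"
  assumes norm_xi: "norm \<xi> = 1" and norm_e: "norm e = 1" and orth: "\<xi> \<bullet> e = 0"
begin

text \<open>Coordinates with origin at \<xi>: \<open>w\<close> is the depth
  \<open>1 - z \<bullet> \<xi>\<close> below the tangent of the circle there. Chords through \<xi>
  become lines through the origin, and the map preserves area.\<close>

definition frame_pt :: "real \<Rightarrow> real \<Rightarrow> real^2" where
  "frame_pt w y = (1 - w) *\<^sub>R \<xi> + y *\<^sub>R e"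

text \<open>The point with coordinates \<open>m + i h\<close> in the upper half-plane model with \<open>\<xi>\<close> at
  infinity; geodesics towards \<open>\<xi>\<close> are the lines of constant \<open>m\<close>, in the disc the
  chords \<open>y = m w\<close> through \<open>\<xi>\<close>.\<close>

definition uhp :: "real \<Rightarrow> real \<Rightarrow> real^2" where
  "uhp m h = frame_pt (2 / (1 + m\<^sup>2 + h\<^sup>2)) (2 / (1 + m\<^sup>2 + h\<^sup>2) * m)"

lemma inner_xi_e [simp]: "\<xi> \<bullet> \<xi> = 1" "e \<bullet> e = 1" "\<xi> \<bullet> e = 0" "e \<bullet> \<xi> = 0"
  using norm_xi norm_e orth by (simp_all add: norm_eq_sqrt_inner inner_commute)

lemma inner_frame_pt: "frame_pt w y \<bullet> frame_pt w' y' = (1 - w) * (1 - w') + y * y'"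
  by (simp add: frame_pt_def inner_add_left inner_add_right)

text \<open>The Lorentzian product of two points splits into one scaling factor for each point and a
  polynomial in the half-plane coordinates. Distances and angles are homogeneous in each point, so
  the factors cancel there.\<close>

lemma one_minus_inner_uhp:
  assumes "h > 0" "k > 0"
  shows "1 - uhp m h \<bullet> uhp n k =
    2 / (1 + m\<^sup>2 + h\<^sup>2) * (2 / (1 + n\<^sup>2 + k\<^sup>2)) * (((m - n)\<^sup>2 + h\<^sup>2 + k\<^sup>2) / 2)"
proof -
  have "1 + m\<^sup>2 + h\<^sup>2 > 0" "1 + n\<^sup>2 + k\<^sup>2 > 0"
    using assms by (simp_all add: add_pos_nonneg)
  then show ?thesis
    unfolding uhp_def inner_frame_pt by (simp add: divide_simps) (simp add: power2_eq_square algebra_simps)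
qed

lemma one_minus_inner_xi_uhp:
  "1 - uhp m h \<bullet> \<xi> = 2 / (1 + m\<^sup>2 + h\<^sup>2)"
  by (simp add: uhp_def frame_pt_def inner_add_left)

lemma one_minus_norm_uhp:
  assumes "h > 0"
  shows "1 - (norm (uhp m h))\<^sup>2 = (2 / (1 + m\<^sup>2 + h\<^sup>2) * h)\<^sup>2"
  using one_minus_inner_uhp[OF assms assms, of m m]
  unfolding power2_norm_eq_inner by (simp add: power2_eq_square)

lemma horo_uhp: "h > 0 \<Longrightarrow> horo \<xi> (uhp m h) = 1 / h"
proof -
  assume h: "h > 0"
  define w where "w = 2 / (1 + m\<^sup>2 + h\<^sup>2)"
  have "w > 0" using h by (simp add: add_pos_nonneg w_def)
  then show ?thesis
    unfolding horo_def one_minus_norm_uhp[OF h] one_minus_inner_xi_uhp w_def[symmetric] using h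
    by simp
qed

lemma hyp_dist_uhp:
  assumes "h > 0" "k > 0"
  shows "hyp_dist (uhp m h) (uhp n k) = arcosh (((m - n)\<^sup>2 + h\<^sup>2 + k\<^sup>2) / (2 * h * k))"
proof -
  define w where "w = 2 / (1 + m\<^sup>2 + h\<^sup>2)"
  define u where "u = 2 / (1 + n\<^sup>2 + k\<^sup>2)"
  have p: "w > 0" "u > 0"
    using assms by (simp_all add: add_pos_nonneg w_def u_def)
  show ?thesis
    unfolding hyp_dist_def one_minus_norm_uhp[OF assms(1)] one_minus_norm_uhp[OF assms(2)]
      one_minus_inner_uhp[OF assms] real_sqrt_mult real_sqrt_abs w_def[symmetric] u_def[symmetric]
    using p assms by (simp add: abs_mult mult.assoc)
qed

end

text \<open>In terms of the Lorentzian form \<open>B v w = 1 - v \<bullet> w\<close>.\<close>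

lemma klein_metric_diff:
  assumes "norm z < 1"
  shows "klein_metric z (v - z) (w - z) =
    ((1 - z \<bullet> v) * (1 - z \<bullet> w) - (1 - (norm z)\<^sup>2) * (1 - v \<bullet> w)) / (1 - (norm z)\<^sup>2)\<^sup>2"
proof -
  have "(norm z)\<^sup>2 < 1" using assms by (simp add: power_less_one_iff)
  then have "1 - z \<bullet> z \<noteq> 0" by (simp add: power2_norm_eq_inner)
  then show ?thesis
    unfolding klein_metric_def power2_norm_eq_inner inner_diff_left inner_diff_right
    by (simp add: divide_simps inner_commute) (simp add: power2_eq_square algebra_simps)
qed

text \<open>An ideal point is a null vector of the Lorentzian form, so its part under the root is a
  perfect square and contributes only \<open>1 - z \<bullet> \<xi>\<close>.\<close>

lemma hyp_angle_ideal:
  assumes "norm z < 1" "norm \<xi> = 1"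
  shows "hyp_angle z v \<xi> = arccos (((1 - z \<bullet> v) * (1 - z \<bullet> \<xi>) - (1 - (norm z)\<^sup>2) * (1 - v \<bullet> \<xi>))
    / ((1 - z \<bullet> \<xi>) * sqrt ((1 - z \<bullet> v)\<^sup>2 - (1 - (norm z)\<^sup>2) * (1 - (norm v)\<^sup>2))))"
proof -
  have d: "1 - (norm z)\<^sup>2 > 0" using assms by (simp add: power_less_one_iff)
  have x: "1 - z \<bullet> \<xi> > 0"
    using norm_cauchy_schwarz[of z \<xi>] assms by simp
  have n: "\<xi> \<bullet> \<xi> = 1" using assms(2) by (simp add: norm_eq_sqrt_inner)
  have "sqrt (klein_metric z (v - z) (v - z) * klein_metric z (\<xi> - z) (\<xi> - z)) =
    (1 - z \<bullet> \<xi>) * sqrt ((1 - z \<bullet> v)\<^sup>2 - (1 - (norm z)\<^sup>2) * (1 - (norm v)\<^sup>2)) / (1 - (norm z)\<^sup>2)\<^sup>2"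
    unfolding klein_metric_diff[OF assms(1)] real_sqrt_mult real_sqrt_divide
    using x d by (simp add: n power2_norm_eq_inner[symmetric]) (simp add: power2_eq_square assms(2))
  then show ?thesis
    unfolding hyp_angle_def using d by (simp add: klein_metric_diff[OF assms(1)])
qed

context ideal_frame begin

lemma norm_uhp: "h > 0 \<Longrightarrow> norm (uhp m h) < 1"
proof -
  assume h: "h > 0"
  have "2 / (1 + m\<^sup>2 + h\<^sup>2) * h > 0" using h by (simp add: add_pos_nonneg)
  then have "(2 / (1 + m\<^sup>2 + h\<^sup>2) * h)\<^sup>2 > 0" by (rule zero_less_power)
  then have "(norm (uhp m h))\<^sup>2 < 1\<^sup>2" unfolding one_minus_norm_uhp[OF h, symmetric] by simp
  then show ?thesis by (rule power_less_imp_less_base) simp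
qed

text \<open>\<open>b\<close> is the centre, on the real axis, of the half-circle through both
  points, and the root is its radius. The tangent is orthogonal to the radius, so its angle with the
  vertical ray has the horizontal offset of the centre over the radius as cosine. The factor
  \<open>sgn (n - m)\<close> lets the lemma serve both ends of a side.\<close>

lemma hyp_angle_uhp:
  assumes "h > 0" "k > 0" "m \<noteq> n"
    and b: "b = (n\<^sup>2 + k\<^sup>2 - m\<^sup>2 - h\<^sup>2) / (2 * (n - m))"
  shows "hyp_angle (uhp m h) (uhp n k) \<xi> = arccos (sgn (n - m) * (b - m) / sqrt (h\<^sup>2 + (m - b)\<^sup>2))"
proof -
  define w where "w = 2 / (1 + m\<^sup>2 + h\<^sup>2)"
  define u where "u = 2 / (1 + n\<^sup>2 + k\<^sup>2)"
  define N where "N = (m - n)\<^sup>2 + h\<^sup>2 + k\<^sup>2"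
  have p: "w > 0" "u > 0"
    using assms by (simp_all add: add_pos_nonneg w_def u_def)
  have bb: "b * (2 * (n - m)) = n\<^sup>2 + k\<^sup>2 - m\<^sup>2 - h\<^sup>2"
    unfolding b using assms by simp
  have 1: "N - 2 * h\<^sup>2 = 2 * ((n - m) * (b - m))"
    unfolding N_def using bb by (simp add: power2_eq_square algebra_simps)
  have r: "h\<^sup>2 + (m - b)\<^sup>2 > 0" using assms by (simp add: add_pos_nonneg)
  have k2: "k\<^sup>2 = b * (2 * (n - m)) - n\<^sup>2 + m\<^sup>2 + h\<^sup>2" using bb by simp
  have 2: "N\<^sup>2 - 4 * h\<^sup>2 * k\<^sup>2 = (2 * (n - m))\<^sup>2 * (h\<^sup>2 + (m - b)\<^sup>2)"
    unfolding N_def k2 by (simp add: power2_eq_square algebra_simps)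
  have "sqrt ((w * u * (N / 2))\<^sup>2 - (w * h)\<^sup>2 * (u * k)\<^sup>2) = sqrt ((w * u)\<^sup>2 / 4 * (N\<^sup>2 - 4 * h\<^sup>2 * k\<^sup>2))"
    by (simp add: power_mult_distrib field_simps)
  also have "\<dots> = sqrt ((w * u * (n - m))\<^sup>2 * (h\<^sup>2 + (m - b)\<^sup>2))"
    unfolding 2 by (simp only: power_mult_distrib) simp
  also have "\<dots> = w * u * \<bar>n - m\<bar> * sqrt (h\<^sup>2 + (m - b)\<^sup>2)"
    using p by (simp add: real_sqrt_mult abs_mult)
  finally have 3: "sqrt ((w * u * (N / 2))\<^sup>2 - (w * h)\<^sup>2 * (u * k)\<^sup>2) = w * u * \<bar>n - m\<bar> * sqrt (h\<^sup>2 + (m - b)\<^sup>2)" .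
  have N: "N / 2 = (n - m) * (b - m) + h\<^sup>2" using 1 by simp
  have 4: "w * u * (N / 2) * w - (w * h)\<^sup>2 * u = w * w * u * ((n - m) * (b - m))"
    unfolding N by (simp add: power2_eq_square algebra_simps)
  have cancel: "w * w * u * (d * e) / (w * (w * u * \<bar>d\<bar> * s)) = sgn d * e / s"
    if "d \<noteq> 0" "s > 0" for d e s
    using that p by (cases "d > 0") (simp_all add: field_simps sgn_if)
  have 5: "w * w * u * ((n - m) * (b - m)) / (w * (w * u * \<bar>n - m\<bar> * sqrt (h\<^sup>2 + (m - b)\<^sup>2)))
     = sgn (n - m) * (b - m) / sqrt (h\<^sup>2 + (m - b)\<^sup>2)"
    by (rule cancel) (use assms(3) r in simp_all)
  show ?thesis
    unfolding hyp_angle_ideal[OF norm_uhp[OF assms(1)] norm_xi]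
      one_minus_norm_uhp[OF assms(1)] one_minus_norm_uhp[OF assms(2)]
      one_minus_inner_uhp[OF assms(1,2)] one_minus_inner_xi_uhp
    unfolding w_def[symmetric] u_def[symmetric] N_def[symmetric] 3 4 5 ..
qed

lemma frame_expand: "z = frame_pt (1 - z \<bullet> \<xi>) (z \<bullet> e)"
proof -
  have n: "\<xi>$1 * \<xi>$1 + \<xi>$2 * \<xi>$2 = 1" "e$1 * e$1 + e$2 * e$2 = 1" "\<xi>$1 * e$1 + \<xi>$2 * e$2 = 0"
    using inner_xi_e by (simp_all add: inner_vec_def sum_2)
  \<comment> \<open>The matrix with rows \<xi> and \<open>e\<close> is orthogonal, so its columns
    are orthonormal too.\<close>
  then have "e$1 * e$1 = \<xi>$2 * \<xi>$2" "\<xi>$1 * \<xi>$1 + e$1 * e$1 = 1" "\<xi>$2 * \<xi>$2 + e$2 * e$2 = 1"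
     "\<xi>$1 * \<xi>$2 + e$1 * e$2 = 0"
    by algebra+
  then have "z$1 = (z$1 * \<xi>$1 + z$2 * \<xi>$2) * \<xi>$1 + (z$1 * e$1 + z$2 * e$2) * e$1"
    "z$2 = (z$1 * \<xi>$1 + z$2 * \<xi>$2) * \<xi>$2 + (z$1 * e$1 + z$2 * e$2) * e$2"
    by algebra+
  then show ?thesis
    by (simp add: frame_pt_def vec_eq_iff forall_2 inner_vec_def sum_2)
qed

lemma uhp_exists:
  assumes "norm z < 1"
  obtains h where "h > 0" "z = uhp (z \<bullet> e / (1 - z \<bullet> \<xi>)) h"
proof -
  define w where "w = 1 - z \<bullet> \<xi>"
  define m where "m = z \<bullet> e / w"
  \<comment> \<open>This height is forced by \<open>horo_uhp\<close>: it is the reciprocal of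
    \<open>horo \<xi> z\<close>.\<close>
  define h where "h = sqrt (1 - (norm z)\<^sup>2) / w"
  have w: "w > 0"
    using norm_cauchy_schwarz[of z \<xi>] assms norm_xi by (simp add: w_def)
  have d: "1 - (norm z)\<^sup>2 > 0" using assms by (simp add: power_less_one_iff)
  have y: "z \<bullet> e = w * m" using w by (simp add: m_def)
  have z: "z = frame_pt w (w * m)"
    using frame_expand[of z] unfolding y w_def by simp
  have "1 - (norm z)\<^sup>2 = w\<^sup>2 * h\<^sup>2" using w d by (simp add: h_def power_divide)
  moreover have "(norm z)\<^sup>2 = (1 - w)\<^sup>2 + (w * m)\<^sup>2"
    unfolding power2_norm_eq_inner by (subst (1 2) z) (simp add: inner_frame_pt power2_eq_square)
  ultimately have "w * (w * (1 + m\<^sup>2 + h\<^sup>2)) = w * 2"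
    by (simp add: power2_eq_square algebra_simps)
  then have "w * (1 + m\<^sup>2 + h\<^sup>2) = 2" using w by simp
  moreover have "1 + m\<^sup>2 + h\<^sup>2 > 0" by (simp add: add_pos_nonneg)
  ultimately have "w = 2 / (1 + m\<^sup>2 + h\<^sup>2)" by (simp add: field_simps)
  then have "z = uhp m h" using z by (simp add: uhp_def)
  moreover have "h > 0" using w d by (simp add: h_def)
  ultimately show ?thesis using that unfolding m_def w_def by blast
qed

end

text \<open>Equal slopes would put both finite vertices on one chord through \<xi>, against
  non-collinearity. The order \<open>m < n\<close> costs nothing, because replacing \<open>e\<close>
  by \<open>-e\<close> reflects the half-plane.\<close>

lemma one_ideal_triangle_uhp:
  assumes "one_ideal_triangle (Triangle P Q \<xi>)"
  obtains e m h n k where "ideal_frame \<xi> e" "m < n" "h > 0" "k > 0"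
    "P = ideal_frame.uhp \<xi> e m h" "Q = ideal_frame.uhp \<xi> e n k"
proof -
  have a: "norm P < 1" "norm Q < 1" "norm \<xi> = 1" "\<not> collinear {P, Q, \<xi>}"
    using assms by (simp_all add: one_ideal_triangle_def)
  define e where "e = (vector [- \<xi>$2, \<xi>$1] :: real^2)"
  have n: "\<xi>$1 * \<xi>$1 + \<xi>$2 * \<xi>$2 = 1"
    using a(3) by (simp add: norm_eq_sqrt_inner inner_vec_def sum_2)
  have fr: "ideal_frame \<xi> e" "ideal_frame \<xi> (-e)"
    using a(3) n by (unfold_locales, simp_all add: e_def norm_eq_sqrt_inner inner_vec_def sum_2)
  define m where "m = P \<bullet> e / (1 - P \<bullet> \<xi>)"
  define n where "n = Q \<bullet> e / (1 - Q \<bullet> \<xi>)"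
  have w: "1 - P \<bullet> \<xi> > 0" "1 - Q \<bullet> \<xi> > 0"
    using norm_cauchy_schwarz[of P \<xi>] norm_cauchy_schwarz[of Q \<xi>] a by simp_all
  have "m \<noteq> n"
  proof
    assume "m = n"
    interpret ideal_frame \<xi> e by fact
    define t where "t = (1 - P \<bullet> \<xi>) / (1 - Q \<bullet> \<xi>)"
    have "P \<bullet> e = (1 - P \<bullet> \<xi>) * m" "Q \<bullet> e = (1 - Q \<bullet> \<xi>) * n"
      using w by (simp_all add: m_def n_def)
    then have "P = frame_pt (1 - P \<bullet> \<xi>) ((1 - P \<bullet> \<xi>) * m)" "Q = frame_pt (1 - Q \<bullet> \<xi>) ((1 - Q \<bullet> \<xi>) * m)"
      using frame_expand[of P] frame_expand[of Q] \<open>m = n\<close> by simp_all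
    then have PQ: "P - \<xi> = (1 - P \<bullet> \<xi>) *\<^sub>R (m *\<^sub>R e - \<xi>)" "Q - \<xi> = (1 - Q \<bullet> \<xi>) *\<^sub>R (m *\<^sub>R e - \<xi>)"
      by (simp_all add: frame_pt_def algebra_simps)
    have "P - \<xi> = t *\<^sub>R (Q - \<xi>)"
      unfolding PQ t_def using w by simp
    then have "P = t *\<^sub>R Q + (1 - t) *\<^sub>R \<xi>" by (simp add: algebra_simps)
    then have "collinear {Q, P, \<xi>}"
      unfolding insert_commute[of Q P] using collinear_3_expand[of Q P \<xi>] by (metis insert_commute)
    then show False using a by (simp add: insert_commute)
  qed
  then consider "m < n" | "-m < -n" by linarith
  then show ?thesis
  proof cases
    case 1
    interpret ideal_frame \<xi> e by fact
    obtain h where "h > 0" "P = uhp m h" using uhp_exists[OF a(1)] m_def by blast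
    moreover obtain k where "k > 0" "Q = uhp n k" using uhp_exists[OF a(2)] n_def by blast
    ultimately show ?thesis using that fr 1 by blast
  next
    case 2
    interpret ideal_frame \<xi> "-e" by fact
    obtain h where "h > 0" "P = uhp (-m) h" using uhp_exists[OF a(1)] by (auto simp: m_def)
    moreover obtain k where "k > 0" "Q = uhp (-n) k" using uhp_exists[OF a(2)] by (auto simp: n_def)
    ultimately show ?thesis using that fr 2 by blast
  qed
qed

section \<open>The area of a triangle with one ideal vertex\<close>

lemma distr_lborel_orthogonal:
  fixes f :: "real^'n::{finite,wellorder} \<Rightarrow> real^'n::_"
  assumes f: "orthogonal_transformation f"
  shows "distr lborel borel f = lborel"
proof (rule lborel_eqI[symmetric])
  have lin: "linear f" using f by (rule orthogonal_transformation_linear)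
  then have [measurable]: "f \<in> borel_measurable borel"
    by (intro borel_measurable_continuous_onI linear_continuous_on) (simp add: linear_conv_bounded_linear)
  fix l u :: "real^'n::_"
  assume le: "\<And>b. b \<in> Basis \<Longrightarrow> l \<bullet> b \<le> u \<bullet> b"
  have inv: "orthogonal_transformation (inv f)" using f by (rule orthogonal_transformation_inv)
  \<comment> \<open>The preimage is rewritten as an image under the inverse, since the invariance of
    Lebesgue measure is stated for images.\<close>
  have vim: "f -` box l u = inv f ` box l u"
    using bij_vimage_eq_inv_image[OF orthogonal_transformation_bij[OF f]] .
  have m: "inv f ` box l u \<in> lmeasurable"
    by (rule measurable_orthogonal_image[OF inv]) (rule lmeasurable_box)
  have open': "inv f ` box l u \<in> sets borel"
    unfolding vim[symmetric] by (rule measurable_sets_borel[of f borel]) simp_all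
  have "emeasure (distr lborel borel f) (box l u) = emeasure lborel (inv f ` box l u)"
    by (simp add: emeasure_distr vim)
  also have "\<dots> = emeasure lebesgue (inv f ` box l u)"
    using open' by simp
  also have "\<dots> = ennreal (measure lebesgue (inv f ` box l u))"
    using m by (rule emeasure_eq_measure2)
  also have "\<dots> = ennreal (measure lebesgue (box l u))"
    using measure_orthogonal_image[OF inv, of "box l u"] by simp
  also have "\<dots> = (\<Prod>b\<in>Basis. (u - l) \<bullet> b)"
    using le by (simp add: measure_lborel_box_eq)
  finally show "emeasure (distr lborel borel f) (box l u) = (\<Prod>b\<in>Basis. (u - l) \<bullet> b)" .
qed simp

lemma vector2_measurable [measurable]:
  "(\<lambda>z::real \<times> real. vector [fst z, snd z] :: real^2) \<in> borel_measurable borel"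
proof -
  have "(\<lambda>z::real \<times> real. vector [fst z, snd z] :: real^2) =
     (\<lambda>z. fst z *\<^sub>R vector [1, 0] + snd z *\<^sub>R vector [0, 1])"
    by (auto simp: fun_eq_iff vec_eq_iff forall_2)
  then show ?thesis by (auto intro!: borel_measurable_continuous_onI continuous_intros)
qed

text \<open>Passes from \<open>real^2\<close> to pairs of reals, where Fubini's theorem
  applies.\<close>

lemma distr_lborel_vector2:
  "distr lborel borel (\<lambda>z::real \<times> real. vector [fst z, snd z] :: real^2) = lborel"
proof (rule lborel_eqI[symmetric])
  fix l u :: "real^2"
  assume le: "\<And>b. b \<in> Basis \<Longrightarrow> l \<bullet> b \<le> u \<bullet> b"
  have B: "(Basis :: (real^2) set) = {axis 1 1, axis 2 1}"
    by (auto simp: Basis_vec_def) (metis exhaust_2)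
  have le': "l$1 \<le> u$1" "l$2 \<le> u$2"
    using le[of "axis 1 1"] le[of "axis 2 1"] by (simp_all add: inner_axis)
  have "(\<lambda>z::real \<times> real. vector [fst z, snd z] :: real^2) -` box l u = {l$1<..<u$1} \<times> {l$2<..<u$2}"
    by (auto simp: mem_box_cart forall_2)
  then have "emeasure (distr lborel borel (\<lambda>z::real \<times> real. vector [fst z, snd z] :: real^2)) (box l u)
      = emeasure (lborel \<Otimes>\<^sub>M lborel) ({l$1<..<u$1} \<times> {l$2<..<u$2})"
    by (simp add: emeasure_distr lborel_prod)
  also have "\<dots> = ennreal (u$1 - l$1) * ennreal (u$2 - l$2)"
    using le' by (simp add: lborel.emeasure_pair_measure_Times)
  also have "\<dots> = (\<Prod>b\<in>Basis. (u - l) \<bullet> b)"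
    using le' by (simp add: B axis_eq_axis inner_axis ennreal_mult')
  finally show "emeasure (distr lborel borel (\<lambda>z::real \<times> real. vector [fst z, snd z] :: real^2)) (box l u)
     = (\<Prod>b\<in>Basis. (u - l) \<bullet> b)" .
qed simp

context ideal_frame begin

lemma distr_frame_pt: "distr lborel borel (\<lambda>z. frame_pt (fst z) (snd z)) = lborel"
proof -
  define f where "f = (\<lambda>v::real^2. v$2 *\<^sub>R e - v$1 *\<^sub>R \<xi>)"
  have "linear f"
    by (rule linearI) (simp_all add: f_def algebra_simps)
  moreover have "norm (f v) = norm v" for v
  proof -
    have "f v \<bullet> f v = v \<bullet> v"
      by (simp add: f_def inner_diff_left inner_diff_right) (simp add: inner_vec_def sum_2)
    then show ?thesis by (simp add: norm_eq_sqrt_inner)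
  qed
  ultimately have f: "orthogonal_transformation f"
    by (simp add: orthogonal_transformation)
  have [measurable]: "f \<in> borel_measurable borel"
    using \<open>linear f\<close> by (intro borel_measurable_continuous_onI linear_continuous_on)
      (simp add: linear_conv_bounded_linear)
  \<comment> \<open>The identification with vectors, an orthogonal map and a translation each
    preserve the measure.\<close>
  have "(\<lambda>z. frame_pt (fst z) (snd z)) = (+) \<xi> \<circ> (f \<circ> (\<lambda>z. vector [fst z, snd z]))"
    by (auto simp: fun_eq_iff frame_pt_def f_def algebra_simps)
  then have "distr lborel borel (\<lambda>z. frame_pt (fst z) (snd z)) =
    distr (distr (distr lborel borel (\<lambda>z::real \<times> real. vector [fst z, snd z])) borel f) borel ((+) \<xi>)"
    by (simp add: distr_distr comp_assoc)
  then show ?thesis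
    unfolding distr_lborel_vector2 distr_lborel_orthogonal[OF f] lborel_distr_plus .
qed

lemma frame_pt_eq_iff: "frame_pt w y = frame_pt w' y' \<longleftrightarrow> w = w' \<and> y = y'"
proof
  assume "frame_pt w y = frame_pt w' y'"
  then have "frame_pt w y \<bullet> \<xi> = frame_pt w' y' \<bullet> \<xi>" "frame_pt w y \<bullet> e = frame_pt w' y' \<bullet> e" by simp_all
  then show "w = w' \<and> y = y'" by (simp add: frame_pt_def inner_add_left)
qed simp

lemma frame_pt_combination:
  assumes "u + v + t = 1"
  shows "u *\<^sub>R frame_pt w y + v *\<^sub>R frame_pt w' y' + t *\<^sub>R \<xi> = frame_pt (u * w + v * w') (u * y + v * y')"
proof -
  have "u *\<^sub>R frame_pt w y + v *\<^sub>R frame_pt w' y' + t *\<^sub>R \<xi> = (u * (1 - w) + v * (1 - w') + t) *\<^sub>R \<xi>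
     + (u * y + v * y') *\<^sub>R e"
    by (simp add: frame_pt_def algebra_simps)
  also have "u * (1 - w) + v * (1 - w') + t = 1 - (u * w + v * w')"
    using assms by (simp add: algebra_simps)
  finally show ?thesis by (simp add: frame_pt_def)
qed

lemma frame_pt_in_hull_nonneg:
  assumes "a > 0" "c > 0" "frame_pt w y \<in> convex hull {frame_pt a (a * m), frame_pt c (c * n), \<xi>}"
  shows "w \<ge> 0"
  using assms by (auto simp: convex_hull_3 frame_pt_combination frame_pt_eq_iff)

text \<open>The triangle is the cone at \<xi> between the slopes \<open>m\<close> and
  \<open>n\<close>, cut off by the line \<open>d * w + b * y = 1\<close>; the hypotheses
  \<open>Da\<close> and \<open>Dc\<close> place the two finite vertices on that line.\<close>

lemma frame_pt_in_hull_iff: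
  assumes "m < n" "a > 0" "c > 0" "w > 0"
    and Da: "a * (d + b * m) = 1" and Dc: "c * (d + b * n) = 1"
  shows "frame_pt w (w * x) \<in> convex hull {frame_pt a (a * m), frame_pt c (c * n), \<xi>} \<longleftrightarrow>
    m \<le> x \<and> x \<le> n \<and> w * (d + b * x) \<le> 1"
proof
  assume "frame_pt w (w * x) \<in> convex hull {frame_pt a (a * m), frame_pt c (c * n), \<xi>}"
  then obtain u v t where uvt: "u \<ge> 0" "v \<ge> 0" "t \<ge> 0" "u + v + t = 1"
    and w: "w = u * a + v * c" and wx: "w * x = u * (a * m) + v * (c * n)"
    by (auto simp: convex_hull_3 frame_pt_combination frame_pt_eq_iff)
  have "w * (x - m) = v * c * (n - m)" using w wx by algebra
  also have "\<dots> \<ge> 0" using uvt assms by simp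
  finally have 1: "m \<le> x" using assms by (simp add: zero_le_mult_iff)
  have "w * (n - x) = u * a * (n - m)" using w wx by algebra
  also have "\<dots> \<ge> 0" using uvt assms by simp
  finally have 2: "x \<le> n" using assms by (simp add: zero_le_mult_iff)
  have "w * (d + b * x) = u + v" using w wx Da Dc by algebra
  then show "m \<le> x \<and> x \<le> n \<and> w * (d + b * x) \<le> 1" using 1 2 uvt by simp
next
  assume x: "m \<le> x \<and> x \<le> n \<and> w * (d + b * x) \<le> 1"
  \<comment> \<open>Barycentric coordinates, found by solving \<open>u * a + v * c = w\<close> and
    \<open>u * (a * m) + v * (c * n) = w * x\<close>. The weight left for \<xi> is nonnegative
    because \<open>u + v = w * (d + b * x)\<close>.\<close>
  define u where "u = w * (n - x) / (n - m) / a"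
  define v where "v = w * (x - m) / (n - m) / c"
  have u: "u * a = w * (n - x) / (n - m)" and v: "v * c = w * (x - m) / (n - m)"
    using assms by (simp_all add: u_def v_def)
  have nn: "u \<ge> 0" "v \<ge> 0" using assms x by (simp_all add: u_def v_def)
  have w: "u * a + v * c = w" and wx: "u * (a * m) + v * (c * n) = w * x"
    unfolding mult.assoc[symmetric] u v times_divide_eq_left add_divide_distrib[symmetric]
    using assms(1) by (auto simp: nonzero_divide_eq_eq algebra_simps)
  have "w * (d + b * x) = d * w + b * (w * x)" by (simp add: algebra_simps)
  also have "\<dots> = d * (u * a + v * c) + b * (u * (a * m) + v * (c * n))" by (simp only: w wx)
  also have "\<dots> = u * (a * (d + b * m)) + v * (c * (d + b * n))" by (simp add: algebra_simps)
  finally have "w * (d + b * x) = u + v" by (simp add: Da Dc)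
  then have "1 - u - v \<ge> 0" using x by simp
  moreover have "frame_pt w (w * x) = u *\<^sub>R frame_pt a (a * m) + v *\<^sub>R frame_pt c (c * n) + (1 - u - v) *\<^sub>R \<xi>"
    by (subst frame_pt_combination) (simp_all add: w wx)
  ultimately show "frame_pt w (w * x) \<in> convex hull {frame_pt a (a * m), frame_pt c (c * n), \<xi>}"
    unfolding convex_hull_3 mem_Collect_eq using nn
    by (intro exI[of _ u] exI[of _ v] exI[of _ "1 - u - v"]) simp
qed

end

text \<open>In the half-plane this is the integral of \<open>1 / y\<^sup>2\<close> along a vertical
  ray from height \<open>sqrt H\<close> upwards. The substitution is
  \<open>w = 2 / (k + y\<^sup>2)\<close>, under which the antiderivative
  \<open>sqrt (w / (2 - k * w))\<close> is just \<open>1 / y\<close>. The integrand is unbounded at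
  the ideal end \<open>w = 0\<close>, hence the fundamental theorem with derivatives only in the
  interior.\<close>

lemma nn_integral_slice:
  fixes k H :: real
  assumes "k > 0" "H > 0"
  shows "(\<integral>\<^sup>+w. ennreal (w * (2 * w - w\<^sup>2 * k) powr (-3/2)) * indicator {0..2 / (k + H)} w \<partial>lborel) =
    ennreal (1 / sqrt H)"
proof -
  define W where "W = 2 / (k + H)"
  have W: "W > 0" using assms by (simp add: W_def)
  have pos: "2 - k * w > 0" if "w \<le> W" for w
  proof -
    have "k * w \<le> k * W" using that assms by simp
    also have "k * W < 2" using assms by (simp add: W_def field_simps)
    finally show ?thesis by simp
  qed
  have "((\<lambda>w. w * (2 * w - w\<^sup>2 * k) powr (-3/2)) has_integral
      (sqrt (W / (2 - k * W)) - sqrt (0 / (2 - k * 0)))) {0..W}"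
  proof (rule fundamental_theorem_of_calculus_interior)
    show "0 \<le> W" using W by simp
    show "continuous_on {0..W} (\<lambda>w. sqrt (w / (2 - k * w)))"
      using pos by (intro continuous_intros) force
    fix w assume "w \<in> {0<..<W}"
    then have w: "w > 0" "2 - k * w > 0" using pos by auto
    define u where "u = 2 - k * w"
    have u: "u > 0" using w u_def by simp
    have e: "2 * w - w\<^sup>2 * k = w * u" by (simp add: u_def power2_eq_square algebra_simps)
    have "(w * u) powr (-3/2) = (w * u) powr (-1 + -(1/2))" by simp
    also have "\<dots> = (w * u) powr (-1) * (w * u) powr (-(1/2))" by (rule powr_add)
    also have "\<dots> = 1 / (w * u) * (1 / sqrt (w * u))"
      using w u by (simp add: powr_minus powr_half_sqrt field_simps)
    finally have p: "w * (w * u) powr (-3/2) = 1 / (u * (sqrt w * sqrt u))"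
      using w u by (simp add: real_sqrt_mult)
    have "((\<lambda>w. sqrt (w / (2 - k * w))) has_real_derivative
       ((2 - k * w) - w * (- k)) / (2 - k * w)\<^sup>2 * (inverse (sqrt (w / (2 - k * w))) / 2)) (at w)"
      using w by (auto intro!: derivative_eq_intros simp: power2_eq_square divide_less_0_iff)
    moreover have "((2 - k * w) - w * (- k)) / (2 - k * w)\<^sup>2 * (inverse (sqrt (w / (2 - k * w))) / 2)
       = w * (w * u) powr (-3/2)"
    proof -
      have "2 / (q * q)\<^sup>2 * (inverse (p / q) / 2) = 1 / (q * q * (p * q))" if "p > 0" "q > 0" for p q :: real
        using that by (simp add: field_simps power2_eq_square)
      from this[of "sqrt w" "sqrt u"]
      have "2 / u\<^sup>2 * (inverse (sqrt (w / u)) / 2) = 1 / (u * (sqrt w * sqrt u))"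
        using w u by (simp add: real_sqrt_divide)
      moreover have "u - w * - k = 2" by (simp add: u_def)
      ultimately show ?thesis unfolding p u_def[symmetric] by simp
    qed
    ultimately show "((\<lambda>w. sqrt (w / (2 - k * w))) has_vector_derivative
       w * (2 * w - w\<^sup>2 * k) powr (-3/2)) (at w)"
      unfolding e has_real_derivative_iff_has_vector_derivative by simp
  qed
  moreover have "W / (2 - k * W) = 1 / H"
  proof -
    have "2 - k * W = 2 * H / (k + H)" using assms by (simp add: W_def field_simps)
    moreover have "2 / s / (2 * H / s) = 1 / H" if "s > 0" for s
      using that assms by (simp add: field_simps)
    from this[of "k + H"] have "W / (2 * H / (k + H)) = 1 / H"
      using assms unfolding W_def by linarith
    ultimately show ?thesis by simp
  qed
  ultimately have "((\<lambda>w. w * (2 * w - w\<^sup>2 * k) powr (-3/2)) has_integral 1 / sqrt H) {0..W}"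
    by (simp add: real_sqrt_divide)
  from nn_integral_has_integral_lebesgue'[OF _ this] show ?thesis
    unfolding W_def by simp
qed

lemma nn_integral_arcsin:
  fixes m n b r :: real
  assumes "m < n" "r > 0" "\<bar>m - b\<bar> < r" "\<bar>n - b\<bar> < r"
  shows "(\<integral>\<^sup>+x. ennreal (1 / sqrt (r\<^sup>2 - (x - b)\<^sup>2)) * indicator {m..n} x \<partial>lborel) =
    ennreal (arcsin ((n - b) / r) - arcsin ((m - b) / r))"
proof (rule nn_integral_has_integral_lebesgue')
  show "((\<lambda>x. 1 / sqrt (r\<^sup>2 - (x - b)\<^sup>2)) has_integral
     arcsin ((n - b) / r) - arcsin ((m - b) / r)) {m..n}"
  proof (rule fundamental_theorem_of_calculus)
    fix x assume x: "x \<in> {m..n}"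
    then have "\<bar>x - b\<bar> < r" using assms by auto
    then have 1: "-1 < (x - b) / r" "(x - b) / r < 1" using assms by (auto simp: field_simps)
    have "1 - ((x - b) / r)\<^sup>2 = (r\<^sup>2 - (x - b)\<^sup>2) / r\<^sup>2"
      using assms by (simp add: field_simps power2_eq_square)
    then have 2: "sqrt (1 - ((x - b) / r)\<^sup>2) = sqrt (r\<^sup>2 - (x - b)\<^sup>2) / r"
      using assms by (simp add: real_sqrt_divide)
    have "((\<lambda>x. arcsin ((x - b) / r)) has_real_derivative
      inverse (sqrt (1 - ((x - b) / r)\<^sup>2)) * (1 / r)) (at x within {m..n})"
      using 1 assms by (auto intro!: derivative_eq_intros)
    then show "((\<lambda>x. arcsin ((x - b) / r)) has_vector_derivative 1 / sqrt (r\<^sup>2 - (x - b)\<^sup>2)) (at x within {m..n})"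
      unfolding 2 has_real_derivative_iff_has_vector_derivative[symmetric] using assms by (simp add: field_simps)
  qed (use assms in simp)
next
  fix x assume x: "x \<in> {m..n}"
  then have "\<bar>x - b\<bar> < r" using assms by auto
  then have "\<bar>x - b\<bar>\<^sup>2 < r\<^sup>2" by (intro power_strict_mono) auto
  then show "0 \<le> 1 / sqrt (r\<^sup>2 - (x - b)\<^sup>2)" by simp
qed

context ideal_frame begin

lemma hyp_area_uhp:
  fixes m n h k :: real
  assumes "m < n" "h > 0" "k > 0"
    and b: "b = (n\<^sup>2 + k\<^sup>2 - m\<^sup>2 - h\<^sup>2) / (2 * (n - m))"
    and r: "r = sqrt (h\<^sup>2 + (m - b)\<^sup>2)"
  shows "hyp_area (convex hull {uhp m h, uhp n k, \<xi>}) = arcsin ((n - b) / r) - arcsin ((m - b) / r)"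
proof -
  \<comment> \<open>In the coordinates \<open>(w, x)\<close> of \<open>frame_pt w (w * x)\<close> the triangle is the region below the
    graph \<open>w = 2 / (1 + x\<^sup>2 + H x)\<close> of its finite side; \<open>b\<close> and \<open>r\<close> are the centre and radius
    of that side as a half-circle in the upper half-plane.\<close>
  define K where "K = convex hull {uhp m h, uhp n k, \<xi>}"
  define d where "d = (1 + r\<^sup>2 - b\<^sup>2) / 2"
  define a where "a = 2 / (1 + m\<^sup>2 + h\<^sup>2)"
  define c where "c = 2 / (1 + n\<^sup>2 + k\<^sup>2)"
  define H where "H = (\<lambda>x. r\<^sup>2 - (x - b)\<^sup>2)"
  have ac: "a > 0" "c > 0"
    using assms by (simp_all add: add_pos_nonneg a_def c_def)
  have bb: "b * (2 * (n - m)) = n\<^sup>2 + k\<^sup>2 - m\<^sup>2 - h\<^sup>2"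
    unfolding b using assms by simp
  have r2: "r\<^sup>2 = h\<^sup>2 + (m - b)\<^sup>2" by (simp add: r)
  have r2': "r\<^sup>2 = k\<^sup>2 + (n - b)\<^sup>2" unfolding r2 using bb by (simp add: power2_eq_square algebra_simps)
  have r0: "r > 0" using assms by (simp add: r add_pos_nonneg)
  have "(m - b)\<^sup>2 < r\<^sup>2" "(n - b)\<^sup>2 < r\<^sup>2"
    using r2 r2' zero_less_power[OF assms(2), of 2] zero_less_power[OF assms(3), of 2] by linarith+
  then have ab: "\<bar>m - b\<bar> < r" "\<bar>n - b\<bar> < r"
    using r0 power_less_imp_less_base[of "\<bar>m - b\<bar>" 2 r] power_less_imp_less_base[of "\<bar>n - b\<bar>" 2 r]
    by simp_all
  \<comment> \<open>\<open>H x\<close> is the squared height of the half-circle above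
    \<open>x\<close>. As the squares of \<open>x\<close> cancel, the graph
    \<open>w = 2 / (1 + x\<^sup>2 + H x)\<close> is the straight line
    \<open>d * w + b * y = 1\<close> with \<open>y = w * x\<close>, as befits a chord.\<close>
  have D: "1 + x\<^sup>2 + H x = 2 * (d + b * x)" for x
  proof -
    have "2 * (d + b * x) = 2 * d + 2 * (b * x)" by simp
    also have "2 * d = 1 + r\<^sup>2 - b\<^sup>2" by (simp add: d_def)
    finally show ?thesis by (simp add: H_def power2_eq_square algebra_simps)
  qed
  have "H m = h\<^sup>2" "H n = k\<^sup>2" using r2 r2' by (simp_all add: H_def)
  then have "a = 2 / (2 * (d + b * m))" "c = 2 / (2 * (d + b * n))"
    unfolding a_def c_def D[symmetric] by simp_all
  then have Da: "a * (d + b * m) = 1" and Dc: "c * (d + b * n) = 1"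
    using ac by auto
  have H_pos: "H x > 0" if "m \<le> x" "x \<le> n" for x
  proof -
    have "\<bar>x - b\<bar> < r" using ab that by auto
    then have "\<bar>x - b\<bar>\<^sup>2 < r\<^sup>2" by (intro power_strict_mono) auto
    then show ?thesis by (simp add: H_def)
  qed
  have K: "K = convex hull {frame_pt a (a * m), frame_pt c (c * n), \<xi>}"
    by (simp add: K_def uhp_def a_def c_def)
  have "closed K" unfolding K_def
    by (intro compact_imp_closed finite_imp_compact_convex_hull) simp
  then have [measurable]: "K \<in> sets borel" by simp
  define g where "g = (\<lambda>z. ennreal (indicator K z * (1 - (norm z)\<^sup>2) powr (-3/2)))"
  have g[measurable]: "g \<in> borel_measurable borel" unfolding g_def by measurable
  have fm [measurable]: "(\<lambda>z. frame_pt (fst z) (snd z)) \<in> borel_measurable borel"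
    unfolding frame_pt_def by (intro borel_measurable_continuous_onI continuous_intros)
  \<comment> \<open>The factor \<open>w\<close> in front is the Jacobian of the substitution
    \<open>y = w * x\<close> at fixed \<open>w\<close>.\<close>
  define G where "G = (\<lambda>w x. if m \<le> x \<and> x \<le> n \<and> 0 \<le> w \<and> w \<le> 2 / (1 + x\<^sup>2 + H x)
     then ennreal (w * (2 * w - w\<^sup>2 * (1 + x\<^sup>2)) powr (-3/2)) else 0)"
  have G[measurable]: "case_prod G \<in> borel_measurable (lborel \<Otimes>\<^sub>M lborel)"
    unfolding G_def H_def by measurable
  have slice: "(\<integral>\<^sup>+y. g (frame_pt w y) \<partial>lborel) = (\<integral>\<^sup>+x. G w x \<partial>lborel)" if "w \<noteq> 0" for w
  proof (cases "w > 0")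
    case True
    have [measurable]: "(\<lambda>y. frame_pt w y) \<in> borel_measurable borel"
      unfolding frame_pt_def by (intro borel_measurable_continuous_onI continuous_intros)
    have "(\<integral>\<^sup>+y. g (frame_pt w y) \<partial>lborel) = ennreal w * (\<integral>\<^sup>+x. g (frame_pt w (w * x)) \<partial>lborel)"
      using nn_integral_real_affine[of "\<lambda>y. g (frame_pt w y)" w 0] True by simp
    also have "\<dots> = (\<integral>\<^sup>+x. ennreal w * g (frame_pt w (w * x)) \<partial>lborel)"
      by (rule nn_integral_cmult[symmetric]) measurable
    also have "\<dots> = (\<integral>\<^sup>+x. G w x \<partial>lborel)"
    proof (rule nn_integral_cong)
      fix x
      have nrm: "1 - (norm (frame_pt w (w * x)))\<^sup>2 = 2 * w - w\<^sup>2 * (1 + x\<^sup>2)"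
        unfolding power2_norm_eq_inner inner_frame_pt by (simp add: power2_eq_square algebra_simps)
      have "frame_pt w (w * x) \<in> K \<longleftrightarrow> m \<le> x \<and> x \<le> n \<and> w * (d + b * x) \<le> 1"
        unfolding K using assms(1) ac True Da Dc by (rule frame_pt_in_hull_iff)
      also have "\<dots> \<longleftrightarrow> m \<le> x \<and> x \<le> n \<and> w \<le> 2 / (1 + x\<^sup>2 + H x)"
      proof (intro conj_cong refl)
        assume "m \<le> x" "x \<le> n"
        then have "1 + x\<^sup>2 + H x > 0" using H_pos[of x] by (simp add: add_nonneg_pos)
        then have "d + b * x > 0" by (simp add: D)
        moreover have "w * q \<le> 1 \<longleftrightarrow> w \<le> 2 / (2 * q)" if "q > 0" for q
          using that by (simp add: pos_le_divide_eq)
        ultimately show "w * (d + b * x) \<le> 1 \<longleftrightarrow> w \<le> 2 / (1 + x\<^sup>2 + H x)"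
          unfolding D by blast
      qed
      finally show "ennreal w * g (frame_pt w (w * x)) = G w x"
        using True by (simp add: g_def G_def nrm ennreal_mult')
    qed
    finally show ?thesis .
  next
    case False
    then have "g (frame_pt w y) = 0" for y
      using frame_pt_in_hull_nonneg[OF ac, of w y m n] that by (auto simp: g_def K indicator_def)
    moreover have "G w x = 0" for x using False that by (simp add: G_def)
    ultimately show ?thesis by simp
  qed
  have "(\<integral>\<^sup>+z. g z \<partial>lborel) = (\<integral>\<^sup>+z. g (frame_pt (fst z) (snd z)) \<partial>lborel)"
    by (subst distr_frame_pt[symmetric]) (simp add: nn_integral_distr)
  also have "\<dots> = (\<integral>\<^sup>+z. g (frame_pt (fst z) (snd z)) \<partial>(lborel \<Otimes>\<^sub>M lborel))"
    by (simp add: lborel_prod)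
  also have "\<dots> = (\<integral>\<^sup>+w. (\<integral>\<^sup>+y. g (frame_pt w y) \<partial>lborel) \<partial>lborel)"
    by (subst lborel.nn_integral_fst[symmetric]) (simp_all add: lborel_prod)
  \<comment> \<open>The substitution degenerates at \<open>w = 0\<close>, which is a null
    set.\<close>
  also have "\<dots> = (\<integral>\<^sup>+w. (\<integral>\<^sup>+x. G w x \<partial>lborel) \<partial>lborel)"
    by (rule nn_integral_cong_AE) (use AE_lborel_singleton[of 0] slice in auto)
  \<comment> \<open>After the exchange the inner integral runs along a single ray towards \<xi>,
    where it is explicit.\<close>
  also have "\<dots> = (\<integral>\<^sup>+x. (\<integral>\<^sup>+w. G w x \<partial>lborel) \<partial>lborel)"
    using lborel_pair.Fubini[OF G] by simp
  also have "\<dots> = (\<integral>\<^sup>+x. ennreal (1 / sqrt (r\<^sup>2 - (x - b)\<^sup>2)) * indicator {m..n} x \<partial>lborel)"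
  proof (rule nn_integral_cong)
    fix x
    show "(\<integral>\<^sup>+w. G w x \<partial>lborel) = ennreal (1 / sqrt (r\<^sup>2 - (x - b)\<^sup>2)) * indicator {m..n} x"
    proof (cases "m \<le> x \<and> x \<le> n")
      case True
      have "1 + x\<^sup>2 > 0" by (simp add: add_pos_nonneg)
      moreover have "H x > 0" using H_pos True by simp
      ultimately have "(\<integral>\<^sup>+w. ennreal (w * (2 * w - w\<^sup>2 * (1 + x\<^sup>2)) powr (-3/2)) * indicator {0..2 / (1 + x\<^sup>2 + H x)} w \<partial>lborel)
        = ennreal (1 / sqrt (H x))"
        by (rule nn_integral_slice)
      moreover have "G w x = ennreal (w * (2 * w - w\<^sup>2 * (1 + x\<^sup>2)) powr (-3/2)) * indicator {0..2 / (1 + x\<^sup>2 + H x)} w" for w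
        using True by (simp add: G_def indicator_def)
      ultimately show ?thesis using True by (simp add: H_def)
    next
      case False
      then have "G w x = 0" for w by (auto simp: G_def)
      then show ?thesis using False by (simp add: indicator_def)
    qed
  qed
  also have "\<dots> = ennreal (arcsin ((n - b) / r) - arcsin ((m - b) / r))"
    using assms(1) r0 ab by (rule nn_integral_arcsin)
  finally have I: "(\<integral>\<^sup>+z. g z \<partial>lborel) = ennreal (arcsin ((n - b) / r) - arcsin ((m - b) / r))" .
  have "(m - b) / r \<le> (n - b) / r" using assms r0 by (simp add: divide_right_mono)
  then have le: "arcsin ((m - b) / r) \<le> arcsin ((n - b) / r)"
    using ab r0 by (intro arcsin_le_arcsin) (auto simp: field_simps)
  have "hyp_area K = (\<integral>z. indicator K z * (1 - (norm z)\<^sup>2) powr (-3/2) \<partial>lborel)"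
    by (simp add: hyp_area_def set_lebesgue_integral_def)
  also have "\<dots> = enn2real (\<integral>\<^sup>+z. g z \<partial>lborel)"
    unfolding g_def by (rule integral_eq_nn_integral) auto
  finally show ?thesis unfolding I K_def using le by simp
qed

end

section \<open>The length of the finite side as a function of the angles\<close>

text \<open>The inverse of Lobachevsky's angle of parallelism, continued to obtuse angles with
  negative values. The perpendicular from the ideal vertex to the line of the finite side meets it
  at these signed distances from the two endpoints.\<close>

definition neg_ln_tan_half :: "real \<Rightarrow> real" where
  "neg_ln_tan_half t = - ln (tan (t / 2))"

lemma tan_half_pos: "0 < t \<Longrightarrow> t < pi \<Longrightarrow> tan (t / 2) > 0"
  by (rule tan_gt_zero) auto

lemma sin_cos_tan_half:
  assumes "0 < t" "t < pi"
  shows "sin t = 2 * tan (t / 2) / (1 + (tan (t / 2))\<^sup>2)"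
    and "cos t = (1 - (tan (t / 2))\<^sup>2) / (1 + (tan (t / 2))\<^sup>2)"
proof -
  have c: "cos (t / 2) > 0" using assms by (intro cos_gt_zero_pi) auto
  have s: "(sin (t / 2))\<^sup>2 + (cos (t / 2))\<^sup>2 = 1" by simp
  have q: "1 + (tan (t / 2))\<^sup>2 = 1 / (cos (t / 2))\<^sup>2"
    using c s by (simp add: tan_def power_divide field_simps)
  show "sin t = 2 * tan (t / 2) / (1 + (tan (t / 2))\<^sup>2)"
    using sin_double[of "t / 2"] c unfolding q by (simp add: tan_def power2_eq_square)
  show "cos t = (1 - (tan (t / 2))\<^sup>2) / (1 + (tan (t / 2))\<^sup>2)"
  proof -
    have "(1 - b / a) / (1 / a) = a - b" if "a > 0" for a b :: real
      using that by (simp add: field_simps)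
    from this[of "(cos (t / 2))\<^sup>2" "(sin (t / 2))\<^sup>2"] show ?thesis
      using cos_double[of "t / 2"] c unfolding q by (simp add: tan_def power_divide)
  qed
qed

lemma tan_half_mult_less_1:
  assumes "0 < s" "0 < t" "s + t < pi"
  shows "tan (s / 2) * tan (t / 2) < 1"
proof -
  have "tan (t / 2) < tan (pi / 2 - s / 2)"
    by (rule tan_monotone) (use assms in auto)
  also have "\<dots> = inverse (tan (s / 2))"
    using tan_cot[of "s / 2"] by simp
  finally show ?thesis
    using tan_half_pos[of s] assms by (simp add: field_simps)
qed

text \<open>The argument of \<open>arcosh\<close> is the hyperbolic cosine law for angles with third
  angle 0. In half-angle tangents \<open>x\<close> and \<open>y\<close> it is the hyperbolic cosine
  of \<open>- ln (x * y)\<close>, and \<open>x * y < 1\<close> selects the nonnegative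
  branch.\<close>

lemma arcosh_neg_ln_tan_half:
  assumes "0 < s" "0 < t" "s + t < pi"
  shows "arcosh ((1 + cos s * cos t) / (sin s * sin t)) = neg_ln_tan_half s + neg_ln_tan_half t"
proof -
  define x where "x = tan (s / 2)"
  define y where "y = tan (t / 2)"
  have xy: "x > 0" "y > 0" "x * y < 1"
    using assms tan_half_pos tan_half_mult_less_1[OF assms] by (simp_all add: x_def y_def)
  define L where "L = neg_ln_tan_half s + neg_ln_tan_half t"
  have L: "L = - ln (x * y)"
    using xy by (simp add: L_def neg_ln_tan_half_def x_def[symmetric] y_def[symmetric] ln_mult)
  have "L \<ge> 0" unfolding L using xy by simp
  have p: "1 + x\<^sup>2 > 0" "1 + y\<^sup>2 > 0" by (simp_all add: add_pos_nonneg)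
  have alg: "(1 + (1 - a) / c * ((1 - b) / d)) / (2 * x / c * (2 * y / d)) = (c * d + (1 - a) * (1 - b)) / (4 * (x * y))"
    if "c > 0" "d > 0" for a b c d
    using that xy by (simp add: field_simps)
  have "(1 + cos s * cos t) / (sin s * sin t) = ((1 + x\<^sup>2) * (1 + y\<^sup>2) + (1 - x\<^sup>2) * (1 - y\<^sup>2)) / (4 * (x * y))"
    using sin_cos_tan_half[of s] sin_cos_tan_half[of t] assms alg[OF p]
    by (simp add: x_def[symmetric] y_def[symmetric])
  also have "(1 + x\<^sup>2) * (1 + y\<^sup>2) + (1 - x\<^sup>2) * (1 - y\<^sup>2) = 2 * (1 + (x * y)\<^sup>2)"
    by (simp add: power2_eq_square algebra_simps)
  also have "2 * (1 + (x * y)\<^sup>2) / (4 * (x * y)) = (inverse (x * y) + x * y) / 2"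
    using xy by (simp add: field_simps power2_eq_square)
  also have "\<dots> = cosh L"
    using xy by (simp add: L cosh_def exp_minus)
  finally show ?thesis
    using \<open>L \<ge> 0\<close> by (simp add: arcosh_cosh_real L_def)
qed

lemma neg_ln_tan_half_deriv:
  assumes "0 < t" "t < pi"
  shows "(neg_ln_tan_half has_real_derivative - 1 / sin t) (at t)"
proof -
  have c: "cos (t / 2) > 0" "sin (t / 2) > 0"
    using assms by (auto intro!: cos_gt_zero_pi sin_gt_zero)
  have "((\<lambda>t. - ln (tan (t / 2))) has_real_derivative
      - (inverse ((cos (t / 2))\<^sup>2) * (1 / 2) / tan (t / 2))) (at t)"
    using c tan_half_pos[OF assms] by (auto intro!: derivative_eq_intros)
  moreover have "- (inverse ((cos (t / 2))\<^sup>2) * (1 / 2) / tan (t / 2)) = - 1 / sin t"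
    using c sin_double[of "t / 2"] by (simp add: tan_def power2_eq_square field_simps)
  ultimately show ?thesis by (simp add: neg_ln_tan_half_def[abs_def])
qed

lemma neg_ln_tan_half_strict_antimono:
  assumes "0 < s" "s < t" "t < pi"
  shows "neg_ln_tan_half t < neg_ln_tan_half s"
  using assms by (intro DERIV_neg_imp_decreasing[OF assms(2)])
    (metis neg_ln_tan_half_deriv divide_neg_pos sin_gt_zero neg_less_0_iff_less zero_less_one less_le_trans le_less_trans)

lemma neg_ln_tan_half_antimono_iff:
  assumes "0 < s" "s < pi" "0 < t" "t < pi"
  shows "neg_ln_tan_half s \<le> neg_ln_tan_half t \<longleftrightarrow> t \<le> s"
  using neg_ln_tan_half_strict_antimono[of s t] neg_ln_tan_half_strict_antimono[of t s] assms
  by (cases s t rule: linorder_cases) auto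

text \<open>Strict convexity on the acute range as a supporting line at \<open>a\<close>: the
  derivative \<open>- 1 / sin t\<close> increases up to \<open>pi / 2\<close>, so the difference
  from the tangent falls before \<open>a\<close> and rises after it.\<close>

lemma neg_ln_tan_half_tangent:
  assumes "0 < x" "x < pi / 2" "0 < a" "a < pi / 2" "x \<noteq> a"
  shows "neg_ln_tan_half a - (x - a) / sin a < neg_ln_tan_half x"
proof -
  define q where "q = (\<lambda>t. neg_ln_tan_half t + t / sin a)"
  have d: "(q has_real_derivative (1 / sin a - 1 / sin t)) (at t)" if "0 < t" "t < pi" for t
    unfolding q_def using that sin_gt_zero[of a] assms
    by (auto intro!: derivative_eq_intros neg_ln_tan_half_deriv)
  have cont: "continuous_on {u..v} q" if "0 < u" "v < pi" for u v
    using that by (intro DERIV_atLeastAtMost_imp_continuous_on) (metis d less_le_trans le_less_trans)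
  have s: "sin u < sin v" "0 < sin u" if "0 < u" "u < v" "v < pi / 2" for u v
    using that by (auto intro!: sin_monotone_2pi sin_gt_zero)
  have "q a < q x"
  proof (cases "x < a")
    case True
    show ?thesis
    proof (rule DERIV_neg_imp_decreasing_open[OF True])
      fix t assume t: "x < t" "t < a"
      have "1 / sin a - 1 / sin t < 0"
        using s[of t a] assms t by (simp add: frac_less2)
      then show "\<exists>y. (q has_real_derivative y) (at t) \<and> y < 0"
        using d[of t] t assms by force
    qed (use cont assms in auto)
  next
    case False
    then have "a < x" using assms by simp
    then show ?thesis
    proof (rule DERIV_pos_imp_increasing_open)
      fix t assume t: "a < t" "t < x"
      have "1 / sin a - 1 / sin t > 0"
        using s[of a t] assms t by (simp add: frac_less2)
      then show "\<exists>y. (q has_real_derivative y) (at t) \<and> y > 0"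
        using d[of t] t assms by force
    qed (use cont assms in auto)
  qed
  then show ?thesis by (simp add: q_def diff_divide_distrib)
qed

text \<open>Holds also when one of the angles is obtuse, where convexity fails. With
  \<open>c\<close> a quarter of the angle sum, the claim becomes
  \<open>tan (c + d) * tan (c - d) < (tan c)\<^sup>2\<close>, and \<open>c < pi / 4\<close> is what
  makes it true.\<close>

lemma neg_ln_tan_half_add:
  assumes "0 < s" "0 < t" "s + t < pi" "s \<noteq> t"
  shows "2 * neg_ln_tan_half ((s + t) / 2) < neg_ln_tan_half s + neg_ln_tan_half t"
proof -
  define c where "c = (s + t) / 4"
  define d where "d = (s - t) / 4"
  have st: "s / 2 = c + d" "t / 2 = c - d" "(s + t) / 2 / 2 = c"
    by (simp_all add: c_def d_def field_simps)
  have c: "0 < c" "c < pi / 4" and d: "d \<noteq> 0" "\<bar>d\<bar> < c" using assms by (auto simp: c_def d_def)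
  have sc: "0 < sin c" "sin c < cos c" "0 < cos c"
    using c sin_gt_zero[of c] cos_gt_zero_pi[of c] sin_monotone_2pi[of c "pi / 2 - c"]
    by (auto simp: cos_sin_eq)
  have cp: "cos (c + d) > 0" "cos (c - d) > 0" using c d by (auto intro!: cos_gt_zero_pi)
  have sp: "sin (c + d) > 0" "sin (c - d) > 0" using c d by (auto intro!: sin_gt_zero)
  have tp: "tan c > 0" "tan (c + d) > 0" "tan (c - d) > 0" using sc sp cp by (simp_all add: tan_def)
  have "\<bar>d\<bar> < pi" using c d by simp
  then have sd: "(sin d)\<^sup>2 > 0" using d sin_gt_zero[of d] sin_gt_zero[of "-d"] by (cases "d > 0") auto
  have c2: "(cos c)\<^sup>2 = 1 - (sin c)\<^sup>2" "(cos d)\<^sup>2 = 1 - (sin d)\<^sup>2" by (simp_all add: cos_squared_eq)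
  have S: "sin (c + d) * sin (c - d) = (sin c)\<^sup>2 - (sin d)\<^sup>2"
  proof -
    have "sin (c + d) * sin (c - d) = (sin c)\<^sup>2 * (cos d)\<^sup>2 - (cos c)\<^sup>2 * (sin d)\<^sup>2"
      by (simp add: sin_add sin_diff power2_eq_square algebra_simps)
    then show ?thesis unfolding c2 by (simp add: algebra_simps)
  qed
  have C: "cos (c + d) * cos (c - d) = (cos c)\<^sup>2 - (sin d)\<^sup>2"
  proof -
    have "cos (c + d) * cos (c - d) = (cos c)\<^sup>2 * (cos d)\<^sup>2 - (sin c)\<^sup>2 * (sin d)\<^sup>2"
      by (simp add: cos_add cos_diff power2_eq_square algebra_simps)
    then show ?thesis unfolding c2 by (simp add: algebra_simps)
  qed
  have pos: "(cos c)\<^sup>2 - (sin d)\<^sup>2 > 0" using cp unfolding C[symmetric] by simp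
  \<comment> \<open>Subtracting the same positive amount from numerator and denominator makes a
    fraction below 1 smaller.\<close>
  have "(sin c)\<^sup>2 < (cos c)\<^sup>2" using sc by (intro power_strict_mono) auto
  then have "(sin d)\<^sup>2 * (sin c)\<^sup>2 < (sin d)\<^sup>2 * (cos c)\<^sup>2" using sd by simp
  then have "((sin c)\<^sup>2 - (sin d)\<^sup>2) / ((cos c)\<^sup>2 - (sin d)\<^sup>2) < (sin c)\<^sup>2 / (cos c)\<^sup>2"
    using pos sc by (simp add: frac_less_eq divide_less_eq less_divide_eq field_simps)
  then have "tan (c + d) * tan (c - d) < tan c * tan c"
    unfolding tan_def times_divide_times_eq S C by (simp add: power2_eq_square)
  then have "ln (tan (c + d) * tan (c - d)) < ln (tan c * tan c)" using tp by simp
  then show ?thesis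
    unfolding neg_ln_tan_half_def st using tp by (simp add: ln_mult)
qed

section \<open>Cusps\<close>

lemma one_ideal_triangle_measurements:
  assumes "one_ideal_triangle T"
  shows "0 < left_angle T" "0 < right_angle T" "left_angle T + right_angle T < pi"
    and "triangle_area T = pi - left_angle T - right_angle T"
    and "finite_side T = neg_ln_tan_half (left_angle T) + neg_ln_tan_half (right_angle T)"
    and "horo (ideal_vertex T) (left_vertex T) / horo (ideal_vertex T) (right_vertex T) =
      sin (right_angle T) / sin (left_angle T)"
proof -
  obtain P Q \<xi> where T: "T = Triangle P Q \<xi>" by (cases T)
  obtain e m h n k where fr: "ideal_frame \<xi> e" and mn: "m < n" and hk: "h > 0" "k > 0"
    and P: "P = ideal_frame.uhp \<xi> e m h" and Q: "Q = ideal_frame.uhp \<xi> e n k"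
    using assms unfolding T by (rule one_ideal_triangle_uhp)
  interpret ideal_frame \<xi> e by fact
  define b where "b = (n\<^sup>2 + k\<^sup>2 - m\<^sup>2 - h\<^sup>2) / (2 * (n - m))"
  define r where "r = sqrt (h\<^sup>2 + (m - b)\<^sup>2)"
  \<comment> \<open>The centre formula with the endpoints exchanged, as \<open>hyp_angle_uhp\<close>
    at the right vertex needs it.\<close>
  have b': "b = (m\<^sup>2 + h\<^sup>2 - n\<^sup>2 - k\<^sup>2) / (2 * (m - n))"
    unfolding b_def using mn by (simp add: divide_simps) (simp add: algebra_simps)
  have bb: "b * (2 * (n - m)) = n\<^sup>2 + k\<^sup>2 - m\<^sup>2 - h\<^sup>2"
    unfolding b_def using mn by simp
  have r2: "r\<^sup>2 = h\<^sup>2 + (m - b)\<^sup>2" by (simp add: r_def)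
  have r2': "r\<^sup>2 = k\<^sup>2 + (n - b)\<^sup>2" unfolding r2 using bb by (simp add: power2_eq_square algebra_simps)
  have r0: "r > 0" using hk by (simp add: r_def add_pos_nonneg)
  have r': "r = sqrt (k\<^sup>2 + (n - b)\<^sup>2)" using r0 r2' by (simp add: real_sqrt_unique)
  have "(m - b)\<^sup>2 < r\<^sup>2" "(n - b)\<^sup>2 < r\<^sup>2"
    using r2 r2' zero_less_power[OF hk(1), of 2] zero_less_power[OF hk(2), of 2] by linarith+
  then have ab: "\<bar>m - b\<bar> < r" "\<bar>n - b\<bar> < r"
    using r0 power_less_imp_less_base[of "\<bar>m - b\<bar>" 2 r] power_less_imp_less_base[of "\<bar>n - b\<bar>" 2 r]
    by simp_all
  define u where "u = (b - m) / r"
  define v where "v = (n - b) / r"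
  \<comment> \<open>\<open>u\<close> and \<open>v\<close> turn out to be the cosines of the two
    angles. The bound \<open>- v < u\<close> is \<open>m < n\<close>, since
    \<open>u + v = (n - m) / r\<close>; it makes the angle sum less than \<open>pi\<close>.\<close>
  have uv: "-1 < u" "u < 1" "-1 < v" "v < 1" "- v < u"
    using ab mn r0 by (auto simp: u_def v_def field_simps)
  have L: "left_angle T = arccos u"
    using hyp_angle_uhp[OF hk _ b_def] mn by (simp add: left_angle_def T P Q r_def[symmetric] u_def)
  have R: "right_angle T = arccos v"
    using hyp_angle_uhp[OF hk(2,1) _ b'] mn by (simp add: right_angle_def T P Q r'[symmetric] v_def)
  have "h\<^sup>2 = r\<^sup>2 - (b - m)\<^sup>2" "k\<^sup>2 = r\<^sup>2 - (n - b)\<^sup>2"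
    using r2 r2' by (simp_all add: power2_commute)
  then have "1 - u\<^sup>2 = (h / r)\<^sup>2" "1 - v\<^sup>2 = (k / r)\<^sup>2"
    unfolding u_def v_def power_divide using r0 by (simp_all add: diff_divide_distrib)
  then have sin: "sin (left_angle T) = h / r" "sin (right_angle T) = k / r"
    unfolding L R using uv r0 hk by (simp_all add: sin_arccos)
  have cos: "cos (left_angle T) = u" "cos (right_angle T) = v"
    unfolding L R using uv by simp_all
  show pos: "0 < left_angle T" "0 < right_angle T"
    unfolding L R using arccos_lt_bounded[of u] arccos_lt_bounded[of v] uv by simp_all
  have "left_angle T < arccos (- v)"
    unfolding L using uv by (intro arccos_less_arccos) auto
  then show sum: "left_angle T + right_angle T < pi"
    unfolding R using uv by (simp add: arccos_minus)
  have as: "arcsin w = pi / 2 - arccos w" if "-1 < w" "w < 1" for w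
    using arccos_arcsin_eq[of w] that by simp
  have "(m - b) / r = - u" by (simp add: u_def minus_divide_left)
  then have "triangle_area T = arcsin v + arcsin u"
    using hyp_area_uhp[OF mn hk b_def r_def] uv
    by (simp add: triangle_area_def T P Q v_def[symmetric] arcsin_minus)
  then show "triangle_area T = pi - left_angle T - right_angle T"
    unfolding L R using uv by (simp add: as)
  have "((m - n)\<^sup>2 + h\<^sup>2 + k\<^sup>2) / (2 * h * k) = 2 * (r\<^sup>2 + (b - m) * (n - b)) / (2 * h * k)"
  proof -
    have "h\<^sup>2 = r\<^sup>2 - (m - b)\<^sup>2" "k\<^sup>2 = r\<^sup>2 - (n - b)\<^sup>2" using r2 r2' by simp_all
    then show ?thesis by (simp add: power2_eq_square algebra_simps)
  qed
  also have "\<dots> = (1 + u * v) / (h / r * (k / r))"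
    using r0 hk by (simp add: u_def v_def field_simps power2_eq_square)
  finally have "finite_side T = arcosh ((1 + u * v) / (h / r * (k / r)))"
    using hyp_dist_uhp[OF hk] by (simp add: finite_side_def T P Q)
  then show "finite_side T = neg_ln_tan_half (left_angle T) + neg_ln_tan_half (right_angle T)"
    using arcosh_neg_ln_tan_half[OF pos sum] by (simp add: sin cos)
  show "horo (ideal_vertex T) (left_vertex T) / horo (ideal_vertex T) (right_vertex T) =
      sin (right_angle T) / sin (left_angle T)"
    unfolding sin using hk r0 by (simp add: T P Q horo_uhp)
qed

text \<open>The vertices are placed symmetrically on the unit half-circle at height
  \<open>sin a\<close>. Their scaling factor is 1, so in the disc they lie on the diameter
  orthogonal to \<xi>.\<close>

lemma isosceles_one_ideal_triangle:
  assumes "0 < a" "a < pi / 2"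
  obtains T where "one_ideal_triangle T" "left_angle T = a" "right_angle T = a"
proof -
  define \<xi> :: "real^2" where "\<xi> = vector [1, 0]"
  define e :: "real^2" where "e = vector [0, 1]"
  interpret ideal_frame \<xi> e
    by unfold_locales (simp_all add: \<xi>_def e_def norm_eq_sqrt_inner inner_vec_def sum_2)
  have c: "cos a > 0" and s: "sin a > 0" using assms by (auto intro!: cos_gt_zero_pi sin_gt_zero)
  define T where "T = Triangle (uhp (- cos a) (sin a)) (uhp (cos a) (sin a)) \<xi>"
  have w: "2 / (1 + (cos a)\<^sup>2 + (sin a)\<^sup>2) = 1" by (simp add: add.assoc)
  have uhp: "uhp (- cos a) (sin a) = vector [0, - cos a]" "uhp (cos a) (sin a) = vector [0, cos a]"
    unfolding uhp_def frame_pt_def power2_minus w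
    by (simp_all add: e_def vec_eq_iff forall_2)
  have "\<not> collinear {uhp (- cos a) (sin a), uhp (cos a) (sin a), \<xi>}"
    unfolding uhp unfolding \<xi>_def using c
    by (auto simp: collinear_3_expand vec_eq_iff forall_2)
  then have "one_ideal_triangle T"
    using norm_uhp[OF s] norm_xi by (simp add: one_ideal_triangle_def T_def)
  moreover have "left_angle T = a" "right_angle T = a"
    using hyp_angle_uhp[OF s s, of "- cos a" "cos a" 0] hyp_angle_uhp[OF s s, of "cos a" "- cos a" 0] c assms
    by (simp_all add: left_angle_def right_angle_def T_def arccos_cos sin_squared_eq[symmetric])
  ultimately show ?thesis using that by blast
qed

section \<open>Minimal and regular sequences of angles\<close>

text \<open>Each side is at least twice the value at the mean angle, which is at least twice the
  tangent at \<open>a\<close>. Tangent values are affine in the means, whose sum the area fixes, so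
  they add up to the bound; equality of the sums forces equality in every term.\<close>

lemma angle_sequence_perimeter:
  fixes \<theta> \<phi> :: "nat \<Rightarrow> real"
  assumes "p \<ge> 1"
    and pos: "\<And>i. i < p \<Longrightarrow> 0 < \<theta> i \<and> 0 < \<phi> i \<and> \<theta> i + \<phi> i < pi"
    and area: "(\<Sum>i<p. pi - \<theta> i - \<phi> i) = real p * (pi - 2 * a)"
    and a: "0 < a" "a < pi / 2"
  shows "(\<Sum>i<p. neg_ln_tan_half (\<theta> i) + neg_ln_tan_half (\<phi> i)) \<ge> real p * (2 * neg_ln_tan_half a)"
    and "(\<Sum>i<p. neg_ln_tan_half (\<theta> i) + neg_ln_tan_half (\<phi> i)) = real p * (2 * neg_ln_tan_half a) \<Longrightarrow>
      i < p \<Longrightarrow> \<theta> i = a \<and> \<phi> i = a"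
proof -
  define s where "s = (\<lambda>i. (\<theta> i + \<phi> i) / 2)"
  define l where "l = (\<lambda>i. neg_ln_tan_half (\<theta> i) + neg_ln_tan_half (\<phi> i))"
  define t where "t = (\<lambda>i. 2 * (neg_ln_tan_half a - (s i - a) / sin a))"
  have s: "0 < s i" "s i < pi / 2" if "i < p" for i
    using pos[OF that] by (auto simp: s_def)
  have 1: "t i \<le> 2 * neg_ln_tan_half (s i) \<and> (t i = 2 * neg_ln_tan_half (s i) \<longrightarrow> s i = a)" if "i < p" for i
  proof (cases "s i = a")
    case False
    then have "neg_ln_tan_half a - (s i - a) / sin a < neg_ln_tan_half (s i)"
      using neg_ln_tan_half_tangent[of "s i" a] s[OF that] a by blast
    moreover have "2 * x \<le> 2 * y \<and> (2 * x = 2 * y \<longrightarrow> Q)" if "x < y" for x y :: real and Q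
      using that by simp
    ultimately show ?thesis unfolding t_def by blast
  qed (simp add: t_def)
  have 2: "2 * neg_ln_tan_half (s i) \<le> l i \<and> (2 * neg_ln_tan_half (s i) = l i \<longrightarrow> \<theta> i = \<phi> i)" if "i < p" for i
    using neg_ln_tan_half_add[of "\<theta> i" "\<phi> i"] pos[OF that] by (cases "\<theta> i = \<phi> i") (auto simp: l_def s_def)
  have "2 * s i = \<theta> i + \<phi> i" for i by (simp add: s_def)
  then have "(\<Sum>i<p. pi - 2 * s i) = real p * (pi - 2 * a)" using area by (simp add: diff_diff_eq)
  then have "(\<Sum>i<p. s i) = real p * a"
    by (simp add: sum_subtractf sum_distrib_left[symmetric]) (simp add: algebra_simps)
  then have "(\<Sum>i<p. s i - a) = 0" by (simp add: sum_subtractf)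
  then have t: "(\<Sum>i<p. t i) = real p * (2 * neg_ln_tan_half a)"
    by (simp add: t_def sum_distrib_left[symmetric] sum_subtractf sum_divide_distrib[symmetric])
  have "t i \<le> l i" if "i < p" for i using 1[OF that] 2[OF that] by linarith
  then have le: "\<And>i. i \<in> {..<p} \<Longrightarrow> t i \<le> l i" by simp
  then show "(\<Sum>i<p. neg_ln_tan_half (\<theta> i) + neg_ln_tan_half (\<phi> i)) \<ge> real p * (2 * neg_ln_tan_half a)"
    unfolding t[symmetric] l_def[symmetric] by (rule sum_mono)
  assume eq: "(\<Sum>i<p. neg_ln_tan_half (\<theta> i) + neg_ln_tan_half (\<phi> i)) = real p * (2 * neg_ln_tan_half a)"
    and i: "i < p"
  have "(\<Sum>i<p. l i) = (\<Sum>i<p. t i)" using eq t by (simp only: l_def)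
  then have "(\<Sum>i<p. l i - t i) = 0" by (simp add: sum_subtractf)
  then have "l i - t i = 0" using i le by (subst (asm) sum_nonneg_eq_0_iff) auto
  then have "t i = 2 * neg_ln_tan_half (s i)" "2 * neg_ln_tan_half (s i) = l i"
    using 1[OF i] 2[OF i] by linarith+
  then have "s i = a" "\<theta> i = \<phi> i" using 1[OF i] 2[OF i] by blast+
  then show "\<theta> i = a \<and> \<phi> i = a" by (simp add: s_def)
qed

lemma regular_angle_sequence_constant:
  fixes \<theta> \<phi> :: "nat \<Rightarrow> real"
  assumes "p \<ge> 1"
    and pos: "\<And>i. i < p \<Longrightarrow> 0 < \<theta> i \<and> 0 < \<phi> i \<and> \<theta> i + \<phi> i < pi"
    and sides: "\<And>i. i < p \<Longrightarrow> neg_ln_tan_half (\<theta> i) + neg_ln_tan_half (\<phi> i) = l"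
    and angles: "\<And>i. i < p \<Longrightarrow> \<phi> i + \<theta> (Suc i mod p) = \<alpha>"
    and horo: "(\<Prod>i<p. sin (\<phi> i) / sin (\<theta> i)) = 1"
  obtains a where "\<And>i. i < p \<Longrightarrow> \<theta> i = a \<and> \<phi> i = a"
proof -
  \<comment> \<open>For a fixed side length, \<open>\<phi>\<close> decreases with \<open>\<theta>\<close>; so if \<open>\<theta>\<close> is maximal at \<open>q\<close>, then
    \<open>\<phi>\<close> is minimal there and equal interior angles make \<open>\<theta>\<close> maximal at the next index.\<close>
  have anti: "\<theta> i \<le> \<theta> j \<longleftrightarrow> \<phi> j \<le> \<phi> i" if "i < p" "j < p" for i j
    using neg_ln_tan_half_antimono_iff[of "\<theta> j" "\<theta> i"] neg_ln_tan_half_antimono_iff[of "\<phi> i" "\<phi> j"]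
      sides[OF that(1)] sides[OF that(2)] pos[OF that(1)] pos[OF that(2)] by auto
  define M where "M = Max (\<theta> ` {..<p})"
  have M_ge: "\<theta> j \<le> M" if "j < p" for j using that by (simp add: M_def)
  have "M \<in> \<theta> ` {..<p}" unfolding M_def using assms(1) lessThan_empty_iff[of p] by (intro Max_in) auto
  then obtain i where i: "i < p" "\<theta> i = M" by auto
  have "\<theta> ((i + j) mod p) = M" for j
  proof (induction j)
    case (Suc j)
    define q where "q = (i + j) mod p"
    have q: "q < p" "\<theta> q = M" using Suc assms(1) by (simp_all add: q_def)
    \<comment> \<open>The predecessor of \<open>q\<close> on the cycle: the interior angle between
      \<open>r\<close> and \<open>q\<close> is compared with the one between \<open>q\<close> and
      its successor.\<close>
    obtain r where r: "r < p" "Suc r mod p = q"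
    proof (cases q)
      case 0
      then show ?thesis using that[of "p - 1"] assms(1) by simp
    next
      case (Suc q')
      then show ?thesis using that[of q'] q by simp
    qed
    have "\<phi> q \<le> \<phi> r" using anti[OF r(1) q(1)] M_ge[OF r(1)] q by simp
    then have "M \<le> \<theta> (Suc q mod p)" using angles[OF q(1)] angles[OF r(1)] r q by simp
    moreover have "Suc q mod p = (i + Suc j) mod p" by (simp add: q_def mod_Suc_eq)
    ultimately show ?case using M_ge[of "Suc q mod p"] assms(1) by simp
  qed (use i in simp)
  \<comment> \<open>As \<open>i < p\<close>, the truncated subtraction is exact, and every index
    \<open>j\<close> is reached.\<close>
  then have "\<theta> ((i + (j + p - i)) mod p) = M" for j by blast
  moreover have "(i + (j + p - i)) mod p = j" if "j < p" for j using that i by simp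
  ultimately have \<theta>: "\<theta> j = M" if "j < p" for j using that by metis
  define N where "N = \<phi> i"
  have \<phi>: "\<phi> j = N" if "j < p" for j
    using anti[OF that i(1)] anti[OF i(1) that] \<theta>[OF that] \<theta>[OF i(1)] by (simp add: N_def)
  have MN: "0 < M" "0 < N" "M + N < pi" using pos[OF i(1)] i by (auto simp: N_def)
  have sp: "sin M > 0" "sin N > 0" using MN by (auto intro!: sin_gt_zero)
  have "(sin N / sin M) ^ p = 1" using horo by (simp add: \<theta> \<phi>)
  then have "sin N / sin M = 1"
    using sp assms(1) by (intro power_eq_imp_eq_base[of "sin N / sin M" p 1]) auto
  then have "sin N = sin M" using sp by simp
  \<comment> \<open>Equal sines leave equal or supplementary angles; \<open>M + N < pi\<close>
    excludes the latter.\<close>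
  then have "N = M"
  proof -
    have "sin N - sin M = 2 * sin ((N - M) / 2) * cos ((N + M) / 2)" by (rule sin_diff_sin)
    moreover have "cos ((N + M) / 2) > 0" using MN by (intro cos_gt_zero_pi) auto
    ultimately have "sin ((N - M) / 2) = 0" using \<open>sin N = sin M\<close> by simp
    moreover have "\<bar>(N - M) / 2\<bar> < pi" using MN by auto
    ultimately show ?thesis using sin_eq_0_pi[of "(N - M) / 2"] by auto
  qed
  then show ?thesis using that \<theta> \<phi> by blast
qed

theorem theorem2p6:
  fixes p :: nat and A :: real
  assumes "p \<ge> 1"
    and "\<exists>C. polygonal_cusp p C \<and> cusp_area C = A"
  shows "\<exists>R. polygonal_cusp p R \<and> cusp_area R = A \<and> regular_cusp R \<and> complete_at_puncture R \<and>
           (\<forall>C. polygonal_cusp p C \<and> cusp_area C = A \<longrightarrow>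
              perimeter R \<le> perimeter C \<and>
              (perimeter C = perimeter R \<longleftrightarrow> regular_cusp C \<and> complete_at_puncture C) \<and>
              (regular_cusp C \<and> complete_at_puncture C \<longrightarrow> same_shape R C))"
proof -
  define \<theta> where "\<theta> = (\<lambda>C i. left_angle (C ! i))"
  define \<phi> where "\<phi> = (\<lambda>C i. right_angle (C ! i))"
  have cusp: "length C = p"
    "\<And>i. i < p \<Longrightarrow> 0 < \<theta> C i \<and> 0 < \<phi> C i \<and> \<theta> C i + \<phi> C i < pi"
    "\<And>i. i < p \<Longrightarrow> side_length C i = neg_ln_tan_half (\<theta> C i) + neg_ln_tan_half (\<phi> C i)"
    "perimeter C = (\<Sum>i<p. neg_ln_tan_half (\<theta> C i) + neg_ln_tan_half (\<phi> C i))"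
    "cusp_area C = (\<Sum>i<p. pi - \<theta> C i - \<phi> C i)"
    "complete_at_puncture C \<longleftrightarrow> (\<Prod>i<p. sin (\<phi> C i) / sin (\<theta> C i)) = 1"
    "\<And>i. i < p \<Longrightarrow> interior_angle C (Suc i mod p) = \<phi> C i + \<theta> C (Suc i mod p)"
    if C: "polygonal_cusp p C" for C
  proof -
    show len: "length C = p" using C by (simp add: polygonal_cusp_def)
    have T: "one_ideal_triangle (C ! i)" if "i < p" for i
      using C that by (simp add: polygonal_cusp_def)
    note M = one_ideal_triangle_measurements[OF T]
    show "\<And>i. i < p \<Longrightarrow> 0 < \<theta> C i \<and> 0 < \<phi> C i \<and> \<theta> C i + \<phi> C i < pi"
      using M by (simp add: \<theta>_def \<phi>_def)
    show side: "\<And>i. i < p \<Longrightarrow> side_length C i = neg_ln_tan_half (\<theta> C i) + neg_ln_tan_half (\<phi> C i)"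
      using M by (simp add: \<theta>_def \<phi>_def side_length_def)
    show "perimeter C = (\<Sum>i<p. neg_ln_tan_half (\<theta> C i) + neg_ln_tan_half (\<phi> C i))"
      using side by (simp add: perimeter_def len)
    show "cusp_area C = (\<Sum>i<p. pi - \<theta> C i - \<phi> C i)"
      using M by (simp add: cusp_area_def len \<theta>_def \<phi>_def)
    show "complete_at_puncture C \<longleftrightarrow> (\<Prod>i<p. sin (\<phi> C i) / sin (\<theta> C i)) = 1"
      using M by (simp add: complete_at_puncture_def len \<theta>_def \<phi>_def)
    fix i assume i: "i < p"
    \<comment> \<open>The predecessor of the successor, correct also when the successor wraps around
      to 0.\<close>
    have "(Suc i mod p + p - 1) mod p = i"
      using i by (cases "Suc i = p") auto
    then show "interior_angle C (Suc i mod p) = \<phi> C i + \<theta> C (Suc i mod p)"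
      by (simp add: interior_angle_def len \<theta>_def \<phi>_def)
  qed
  \<comment> \<open>The angle for which \<open>p\<close> isosceles triangles have total area
    \<open>A\<close>.\<close>
  define a where "a = (pi - A / p) / 2"
  have "pi - 2 * ((pi - q) / 2) = q" for q by (simp add: field_simps)
  then have "pi - 2 * a = A / p" unfolding a_def .
  then have pa: "real p * (pi - 2 * a) = A" using assms(1) by simp
  obtain C0 where C0: "polygonal_cusp p C0" "cusp_area C0 = A" using assms(2) by blast
  \<comment> \<open>The assumed cusp of area \<open>A\<close> supplies these bounds, which put
    \<open>a\<close> strictly between 0 and \<open>pi / 2\<close>.\<close>
  have "0 < A" "A < real p * pi"
  proof -
    have ne: "{..<p} \<noteq> {}" using assms(1) by (auto simp: lessThan_empty_iff)
    have A: "A = (\<Sum>i<p. pi - \<theta> C0 i - \<phi> C0 i)" using cusp(5)[OF C0(1)] C0(2) by simp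
    show "0 < A" unfolding A
      by (rule sum_pos) (use ne cusp(2)[OF C0(1)] in \<open>force+\<close>)
    have "A < (\<Sum>i<p. pi)" unfolding A
      by (rule sum_strict_mono) (use ne cusp(2)[OF C0(1)] in \<open>force+\<close>)
    then show "A < real p * pi" by simp
  qed
  then have a: "0 < a" "a < pi / 2"
    using assms(1) by (simp_all add: a_def field_simps)
  obtain T where T: "one_ideal_triangle T" "left_angle T = a" "right_angle T = a"
    using isosceles_one_ideal_triangle[OF a] .
  define R where "R = replicate p T"
  have cR: "polygonal_cusp p R" using T assms(1) by (simp add: polygonal_cusp_def R_def)
  have Rang: "\<theta> R i = a \<and> \<phi> R i = a" if "i < p" for i
    using that T by (simp add: \<theta>_def \<phi>_def R_def)
  have iso: "perimeter C = real p * (2 * neg_ln_tan_half a) \<and> cusp_area C = A \<and> regular_cusp C \<and>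
     complete_at_puncture C"
    if C: "polygonal_cusp p C" and ang: "\<And>i. i < p \<Longrightarrow> \<theta> C i = a \<and> \<phi> C i = a" for C
  proof (intro conjI)
    show "perimeter C = real p * (2 * neg_ln_tan_half a)" using ang by (simp add: cusp(4)[OF C])
    show "cusp_area C = A" using ang pa by (simp add: cusp(5)[OF C])
    have "sin a > 0" using a by (intro sin_gt_zero) auto
    then show "complete_at_puncture C" using ang by (simp add: cusp(6)[OF C])
    have "interior_angle C i = 2 * a" if "i < p" for i
    proof -
      have "(i + p - 1) mod p < p" using assms(1) by simp
      then show ?thesis using ang[of "(i + p - 1) mod p"] ang[OF that]
        by (simp add: interior_angle_def cusp(1)[OF C] \<theta>_def \<phi>_def)
    qed
    then show "regular_cusp C" using ang by (simp add: regular_cusp_def cusp(1)[OF C] cusp(3)[OF C])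
  qed
  have "perimeter R \<le> perimeter C \<and>
        (perimeter C = perimeter R \<longleftrightarrow> regular_cusp C \<and> complete_at_puncture C) \<and>
        (regular_cusp C \<and> complete_at_puncture C \<longrightarrow> same_shape R C)"
    if C: "polygonal_cusp p C" "cusp_area C = A" for C
  proof -
    have area: "(\<Sum>i<p. pi - \<theta> C i - \<phi> C i) = real p * (pi - 2 * a)"
      using cusp(5)[OF C(1)] C(2) pa by simp
    note per = angle_sequence_perimeter[OF assms(1) cusp(2)[OF C(1)] area a, folded cusp(4)[OF C(1)]]
    have R: "perimeter R = real p * (2 * neg_ln_tan_half a)" using iso[OF cR Rang] by blast
    have reg: "\<theta> C i = a \<and> \<phi> C i = a" if rc: "regular_cusp C" "complete_at_puncture C" and i: "i < p" for i
    proof -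
      have p0: "0 < p" using assms(1) by simp
      have sides: "neg_ln_tan_half (\<theta> C i) + neg_ln_tan_half (\<phi> C i) = side_length C 0" if "i < p" for i
        using rc(1) that p0 cusp(3)[OF C(1) that] unfolding regular_cusp_def cusp(1)[OF C(1)] by metis
      have angles: "\<phi> C i + \<theta> C (Suc i mod p) = interior_angle C 0" if "i < p" for i
        using rc(1) p0 cusp(7)[OF C(1) that] unfolding regular_cusp_def cusp(1)[OF C(1)]
        by (metis mod_less_divisor)
      obtain a' where a': "\<And>i. i < p \<Longrightarrow> \<theta> C i = a' \<and> \<phi> C i = a'"
        using regular_angle_sequence_constant[of p "\<theta> C" "\<phi> C" "side_length C 0" "interior_angle C 0"]
          assms(1) cusp(2)[OF C(1)] sides angles rc(2) cusp(6)[OF C(1)] by blast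
      \<comment> \<open>The common angle of a regular complete cusp is determined by its
        area.\<close>
      have "real p * (pi - 2 * a') = real p * (pi - 2 * a)" using area a' by simp
      then have "a' = a" using p0 by simp
      then show ?thesis using a' i by blast
    qed
    have "same_shape R C" if rc: "regular_cusp C" "complete_at_puncture C"
      unfolding same_shape_def
    proof (intro conjI allI impI)
      show "length R = length C" by (simp add: cusp(1)[OF C(1)] cusp(1)[OF cR])
      fix i assume "i < length R"
      then have i: "i < p" by (simp add: cusp(1)[OF cR])
      show "left_angle (R ! i) = left_angle (C ! i)" "right_angle (R ! i) = right_angle (C ! i)"
        using reg[OF rc i] Rang[OF i] by (simp_all add: \<theta>_def \<phi>_def)
      show "finite_side (R ! i) = finite_side (C ! i)"
        using cusp(3)[OF C(1) i] cusp(3)[OF cR i] reg[OF rc i] Rang[OF i] by (simp add: side_length_def)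
    qed
    \<comment> \<open>Both sides are equivalent to all angles being \<open>a\<close>:
      \<open>per(2)\<close> and \<open>reg\<close> lead there, and \<open>iso\<close> leads
      back.\<close>
    moreover have "perimeter C = perimeter R \<longleftrightarrow> regular_cusp C \<and> complete_at_puncture C"
      using per(2) iso[OF C(1)] reg R by metis
    ultimately show ?thesis using per(1) R by simp
  qed
  then show ?thesis using iso[OF cR Rang] cR by blast
qed

end
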